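(* Let $0<p_-<p_+\le1/2$, let $\rho$ be a Borel probability measure supported on $[p_-,p_+]$, and let $$\nu_\rho(E)=\int_{p_-}^{p_+}\mu_p(E)\,d\rho(p)\qquad(E\subseteq[0,1]\text{ Borel}).$$ Set $h_2(p)=-p\log p-(1-p)\log(1-p)$. Then $\nu_\rho$ is atomless, has support $[0,1]$, and satisfies $$\nu_\rho(Q)\le(1-p_-)^n\qquad(Q\in\mathcal D_n),$$ so that $\nu_\rho(Q)\le C2^{-an}$ for all $Q\in\mathcal D_n$, $n\ge0$, with $a=-\log(1-p_-)>0$ and $C=1$. For $\nu_\rho$-almost every $x$, the binary digit frequency $p(x)=\lim_{n\to\infty}\frac1n\sum_{j=1}^n\omega_j(x)$ exists, and the dyadic local dimension satisfies $$s(x):=\lim_{n\to\infty}\frac{-\log\nu_\rho(Q_n(x))}{n}=h_2(p(x)).$$ Moreover, $$p_*\nu_\rho=\rho,\qquad s_*\nu_\rho=(h_2)_*\rho.$$ Consequently, both dimension limits $h(\nu_\rho)$ and $D_0(\nu_\rho)$ exist and $$h(\nu_\rho)=\int_{p_-}^{p_+}h_2(p)\,d\rho(p),\qquad D_0(\nu_\rho)=\Bigl(\int_{p_-}^{p_+}\frac1{h_2(p)}\,d\rho(p)\Bigr)^{-1}.$$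
   Context: $\log$ is the logarithm to base 2 and $\ln$ the natural logarithm. $\mathcal D_n$ is the partition of $[0,1]$ into the $2^n$ half-open dyadic intervals of length $2^{-n}$ (the point $1$ being assigned to the last interval), and $Q_n(x)$ is the interval of $\mathcal D_n$ containing $x$. $\omega_j(x)\in\{0,1\}$ is the $j$-th binary digit of $x$ (dyadic endpoints have zero mass and are disregarded). For $p\in(0,1)$, $\mu_p$ is the law on $[0,1]$ of $\sum_{j\ge1}\omega_j2^{-j}$, where the digits $\omega_j\in\{0,1\}$ are independent with $\mathbb P(\omega_j=1)=p$. For a Borel probability measure $\nu$ on $[0,1]$: $h(\nu)=\lim_{k\to\infty}-\frac1k\sum_{Q\in\mathcal D_k}\nu(Q)\log\nu(Q)$, and $D_0(\nu)=\lim_{N\to\infty}\frac{\log N}{-\log\mathfrak e_{N,0}(\nu)}$, where $\mathfrak e_{N,0}(\nu)=\inf_{1\le\#A\le N}\exp\bigl(\int\ln d(x,A)\,d\nu(x)\bigr)$, infimum over non-empty finite $A\subset\mathbb{R}$, $d(x,A)=\inf_{y\in A}|x-y|$. *)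

theory Defs
  imports "HOL-Probability.Probability"
begin

text \<open>
  A Borel measure on \<open>[0,1]\<close> is represented by a measure on \<^term>\<open>borel :: real measure\<close> that gives
  full mass to \<^term>\<open>{0..1::real}\<close>.
\<close>

section \<open>Dyadic intervals and binary digits\<close>

definition dyadic_interval :: "nat \<Rightarrow> nat \<Rightarrow> real set" where
  "dyadic_interval n k =
     (if Suc k = 2 ^ n then {real k / 2 ^ n .. 1}
      else {real k / 2 ^ n ..< real (Suc k) / 2 ^ n})"

definition dyadic :: "nat \<Rightarrow> real set set" where
  "dyadic n = dyadic_interval n ` {..<2 ^ n}"

text \<open>Meaningful for \<^term>\<open>x \<in> {0..1::real}\<close> only.\<close>

definition dyadic_at :: "nat \<Rightarrow> real \<Rightarrow> real set" where
  "dyadic_at n x = (THE Q. Q \<in> dyadic n \<and> x \<in> Q)"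

text \<open>The \<open>j\<close>-th binary digit, \<open>j \<ge> 1\<close>, with the terminating expansion at dyadic points and all digits \<open>0\<close> at \<open>1\<close>.\<close>

definition bin_digit :: "nat \<Rightarrow> real \<Rightarrow> nat" where
  "bin_digit j x = nat (\<lfloor>2 ^ j * x\<rfloor> mod 2)"

definition digit_average :: "nat \<Rightarrow> real \<Rightarrow> real" where
  "digit_average n x = (1 / real n) * (\<Sum>j=1..n. real (bin_digit j x))"

definition digit_freq :: "real \<Rightarrow> real" where
  "digit_freq x = lim (\<lambda>n. digit_average n x)"

section \<open>Support, local dimension and entropy\<close>

definition msupport :: "'a::topological_space measure \<Rightarrow> 'a set" where
  "msupport M = {x. \<forall>U. open U \<longrightarrow> x \<in> U \<longrightarrow> 0 < emeasure M U}"

text \<open>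
  Where \<open>x\<close> lies in a dyadic interval of mass \<open>0\<close> the value below is \<open>0\<close> instead of \<open>\<infinity>\<close>; this
  happens only on a null set.
\<close>

definition local_dim_at_level :: "real measure \<Rightarrow> nat \<Rightarrow> real \<Rightarrow> real" where
  "local_dim_at_level \<nu> n x = - log 2 (measure \<nu> (dyadic_at n x)) / real n"

definition local_dim :: "real measure \<Rightarrow> real \<Rightarrow> real" where
  "local_dim \<nu> x = lim (\<lambda>n. local_dim_at_level \<nu> n x)"

text \<open>The convention \<open>0 log 0 = 0\<close> holds because of the factor \<^term>\<open>0::real\<close>.\<close>

definition entropy_at_level :: "real measure \<Rightarrow> nat \<Rightarrow> real" where
  "entropy_at_level \<nu> k = - (1 / real k) * (\<Sum>Q\<in>dyadic k. measure \<nu> Q * log 2 (measure \<nu> Q))"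

definition entropy_dim :: "real measure \<Rightarrow> real" where
  "entropy_dim \<nu> = lim (entropy_at_level \<nu>)"

definition h2 :: "real \<Rightarrow> real" where
  "h2 p = - p * log 2 p - (1 - p) * log 2 (1 - p)"

section \<open>Quantization dimension of order zero\<close>

text \<open>
  The integral of \<open>ln d(x,A)\<close> may be \<open>-\<infinity>\<close> (for instance if \<open>A\<close> carries mass), in which case its
  exponential is \<open>0\<close>. The Bochner integral and the convention \<^prop>\<open>ln (0::real) = 0\<close> would give
  wrong values, so the logarithm, the integral and the exponential are taken in the extended
  reals. For a measure on \<open>[0,1]\<close> the positive part always has a finite integral.
\<close>

definition ext_ln :: "real \<Rightarrow> ereal" where
  "ext_ln t = (if t \<le> 0 then - \<infinity> else ereal (ln t))"

definition ext_exp :: "ereal \<Rightarrow> ereal" where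
  "ext_exp u = (case u of ereal r \<Rightarrow> ereal (exp r) | PInfty \<Rightarrow> \<infinity> | MInfty \<Rightarrow> 0)"

definition ext_integral :: "'a measure \<Rightarrow> ('a \<Rightarrow> ereal) \<Rightarrow> ereal" where
  "ext_integral M f =
     enn2ereal (\<integral>\<^sup>+x. e2ennreal (f x) \<partial>M) - enn2ereal (\<integral>\<^sup>+x. e2ennreal (- f x) \<partial>M)"

definition quant_error0 :: "real measure \<Rightarrow> nat \<Rightarrow> real" where
  "quant_error0 \<nu> N = real_of_ereal
     (INF A\<in>{A :: real set. finite A \<and> 1 \<le> card A \<and> card A \<le> N}.
        ext_exp (ext_integral \<nu> (\<lambda>x. ext_ln (infdist x A))))"

text \<open>
  If the error vanishes, the ratio below is \<open>0\<close> by \<^prop>\<open>ln (0::real) = 0\<close> and division by zero, which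
  is also its value under the convention \<open>- log 0 = \<infinity>\<close>.
\<close>

definition quant_ratio0 :: "real measure \<Rightarrow> nat \<Rightarrow> real" where
  "quant_ratio0 \<nu> N = log 2 (real N) / (- log 2 (quant_error0 \<nu> N))"

definition quant_dim0 :: "real measure \<Rightarrow> real" where
  "quant_dim0 \<nu> = lim (quant_ratio0 \<nu>)"

section \<open>Bernoulli measures and their mixtures\<close>

text \<open>The coordinate \<open>\<omega> j\<close> is the digit of index \<open>j + 1\<close>.\<close>

definition coin_space :: "real \<Rightarrow> (nat \<Rightarrow> bool) measure" where
  "coin_space p = PiM UNIV (\<lambda>_. measure_pmf (bernoulli_pmf p))"

definition bernoulli_measure :: "real \<Rightarrow> real measure" where
  "bernoulli_measure p =
     distr (coin_space p) borel (\<lambda>\<omega>. \<Sum>j. of_bool (\<omega> j) / 2 ^ Suc j)"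

definition bernoulli_mixture :: "real measure \<Rightarrow> real measure" where
  "bernoulli_mixture \<rho> = \<rho> \<bind> bernoulli_measure"

lemma measurable_coin_space:
  "coin_space \<in> measurable borel (prob_algebra (PiM UNIV (\<lambda>_. count_space UNIV)))"
proof (rule measurable_prob_algebra_generated)
  let ?N = "\<lambda>_::nat. count_space (UNIV :: bool set)"
  show "sets (PiM UNIV ?N) = sigma_sets (\<Pi>\<^sub>E i\<in>UNIV. space (?N i)) (prod_algebra UNIV ?N)"
    by (rule sets_PiM)
  show "Int_stable (prod_algebra UNIV ?N)"
    by (rule Int_stable_prod_algebra)
  show "prod_algebra UNIV ?N \<subseteq> Pow (\<Pi>\<^sub>E i\<in>UNIV. space (?N i))"
    by (rule prod_algebra_sets_into_space)
  show "prob_space (coin_space p)" for p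
    unfolding coin_space_def by (intro prob_space_PiM prob_space_measure_pmf)
  show "sets (coin_space p) = sets (PiM UNIV ?N)" for p
    unfolding coin_space_def by (intro sets_PiM_cong) auto
  fix A assume "A \<in> prod_algebra UNIV ?N"
  then obtain J E where A: "A = prod_emb UNIV ?N J (Pi\<^sub>E J E)" and J: "finite J"
    by (elim prod_algebraE) auto
  have "emeasure (coin_space p) A = (\<Prod>i\<in>J. emeasure (measure_pmf (bernoulli_pmf p)) (E i))" for p
  proof -
    have "A = prod_emb UNIV (\<lambda>_. measure_pmf (bernoulli_pmf p)) J (Pi\<^sub>E J E)"
      unfolding A prod_emb_def by simp
    then show ?thesis
      unfolding coin_space_def using J
      by (simp add: emeasure_PiM_emb prob_space_measure_pmf)
  qed
  moreover have "(\<lambda>p. emeasure (measure_pmf (bernoulli_pmf p)) S) \<in> borel_measurable borel" for S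
  proof -
    have "emeasure (measure_pmf (bernoulli_pmf p)) S =
        ennreal (\<Sum>b\<in>S. if b then min 1 (max 0 p) else 1 - min 1 (max 0 p))" for p
      by (subst emeasure_measure_pmf_finite)
         (auto simp: bernoulli_pmf.rep_eq intro!: arg_cong[where f = ennreal] sum.cong)
    then show ?thesis
      by (auto cong del: sum.cong_simp
               intro!: measurable_compose[OF _ measurable_ennreal] borel_measurable_sum split: if_splits)
  qed
  ultimately show "(\<lambda>p. emeasure (coin_space p) A) \<in> borel_measurable borel"
    by (auto intro!: borel_measurable_prod_ennreal)
qed

lemma measurable_bernoulli_measure:
  "bernoulli_measure \<in> measurable borel (prob_algebra borel)"
  unfolding bernoulli_measure_def
  by (rule measurable_distr_prob_space2[OF measurable_coin_space]) measurable

text \<open>The formula by which the mixture is usually defined.\<close>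

lemma emeasure_bernoulli_mixture:
  assumes "prob_space \<rho>" "sets \<rho> = sets borel" "E \<in> sets borel"
  shows "emeasure (bernoulli_mixture \<rho>) E = (\<integral>\<^sup>+p. emeasure (bernoulli_measure p) E \<partial>\<rho>)"
proof -
  have "bernoulli_measure \<in> measurable \<rho> (subprob_algebra borel)"
    using measurable_prob_algebraD[OF measurable_bernoulli_measure] assms(2)
    by (simp cong: measurable_cong_sets)
  then show ?thesis
    unfolding bernoulli_mixture_def
    using assms prob_space.not_empty by (intro emeasure_bind) auto
qed

end

theory Submission
  imports Defs "HOL-Real_Asymp.Real_Asymp"
begin

text \<open>
  Under \<open>\<mu>\<^sub>p\<close> the digits have frequency \<open>p\<close> almost surely (Hoeffding and Borel--Cantelli), so the
  frequency recovers the mixing parameter. The mass of the cell of \<open>x\<close> at level \<open>n\<close> is the average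
  over \<open>\<rho>\<close> of \<open>2 powr (- n * H n q)\<close>, where \<open>H n q\<close> is the cross entropy of the empirical frequency
  relative to \<open>q\<close>. Gibbs' inequality bounds this average from above, and the values of \<open>q\<close> near
  \<open>p\<close>, which have positive \<open>\<rho>\<close>-mass, bound it from below. Dominated convergence gives the entropy.

  For the quantization error, let \<open>c T x\<close> be the number of levels at which the cell of \<open>x\<close> has mass
  at least \<open>2 powr (- T)\<close>. Since \<open>c T x / T\<close> tends to \<open>1 / s x\<close>, it suffices that \<open>- log e\<close> of the
  \<open>N\<close>-point error \<open>e\<close> is the mean of \<open>c T\<close> up to \<open>o(log N)\<close> for \<open>T = log N \<plusminus> sqrt (log N)\<close>. The endpoints
  of all heavy cells are at most \<open>(T / a + 1) * 2 powr T\<close> many points, which gives one inequality. For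
  the other one, the points within \<open>2 powr (- j)\<close> of an \<open>N\<close>-point set are covered by \<open>3 N\<close> cells of
  level \<open>j\<close>; the light ones among them have total mass at most \<open>3 N * 2 powr (- T)\<close>, and the layer
  cake formula sums this over the relevant levels.
\<close>

section \<open>Binary expansions\<close>

definition bin_value :: "(nat \<Rightarrow> bool) \<Rightarrow> real" where
  "bin_value \<omega> = (\<Sum>j. of_bool (\<omega> j) / 2 ^ Suc j)"

lemma summable_bin_value: "summable (\<lambda>j. of_bool (\<omega> j) / 2 ^ Suc j :: real)"
proof (rule summable_comparison_test')
  show "summable (\<lambda>j. (1/2::real) ^ Suc j)"
    by (simp only: summable_Suc_iff) (simp add: summable_geometric)
qed (simp add: power_divide)

text \<open>Self-similarity: dropping the first digit doubles the value modulo integers. This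
  recursion drives the induction that recovers the digits.\<close>

lemma bin_value_unfold: "bin_value \<omega> = (of_bool (\<omega> 0) + bin_value (\<lambda>j. \<omega> (Suc j))) / 2"
proof -
  have "bin_value \<omega> = of_bool (\<omega> 0) / 2 + (\<Sum>j. of_bool (\<omega> (Suc j)) / 2 ^ Suc (Suc j))"
    unfolding bin_value_def using suminf_split_head[OF summable_bin_value, of \<omega>] by simp
  also have "(\<Sum>j. of_bool (\<omega> (Suc j)) / 2 ^ Suc (Suc j)) = bin_value (\<lambda>j. \<omega> (Suc j)) / 2"
    unfolding bin_value_def
    by (subst suminf_divide[OF summable_bin_value, symmetric]) (simp add: mult.commute)
  finally show ?thesis by (simp add: add_divide_distrib)
qed

lemma bin_value_nonneg: "0 \<le> bin_value \<omega>"
  unfolding bin_value_def by (intro suminf_nonneg summable_bin_value) simp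

text \<open>Termwise comparison with the geometric series of sum \<open>1\<close>: the digit
  \<open>0\<close> at place \<open>i\<close> makes the difference strictly positive.\<close>

lemma bin_value_less_1:
  assumes "\<not> \<omega> i"
  shows "bin_value \<omega> < 1"
proof -
  have *: "(\<lambda>j. (1/2::real) ^ Suc j) sums 1" by (rule power_half_series)
  have "0 < (\<Sum>j. (1/2) ^ Suc j - of_bool (\<omega> j) / 2 ^ Suc j :: real)"
    using assms
    by (intro suminf_pos2[where i = i] summable_diff sums_summable[OF *] summable_bin_value)
       (auto simp: power_divide)
  also have "\<dots> = 1 - bin_value \<omega>"
    unfolding bin_value_def
    using suminf_diff[OF sums_summable[OF *] summable_bin_value, of \<omega>] sums_unique[OF *] by simp
  finally show ?thesis by simp
qed

text \<open>Halving commutes with the floor up to integer division by \<open>2\<close>, and the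
  remainder is the next digit.\<close>

lemma floor_double: "\<lfloor>2 ^ Suc n * x\<rfloor> = 2 * \<lfloor>2 ^ n * x\<rfloor> + int (bin_digit (Suc n) x)"
  for x :: real
proof -
  have "\<lfloor>2 ^ n * x\<rfloor> = \<lfloor>2 ^ Suc n * x\<rfloor> div 2"
    using floor_divide_real_eq_div[of 2 "2 ^ Suc n * x"] by simp
  then show ?thesis
    unfolding bin_digit_def by (simp add: mult_div_mod_eq)
qed

text \<open>Infinitely many zeros exclude the expansions that end in ones, for which
  \<open>bin_digit\<close> reads off the terminating expansion instead. Shifting the sequence
  reduces every digit to the first one.\<close>

lemma bin_digit_bin_value:
  assumes "\<And>m. \<exists>j\<ge>m. \<not> \<omega> j"
  shows "bin_digit (Suc j) (bin_value \<omega>) = of_bool (\<omega> j)"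
  using assms
proof (induction j arbitrary: \<omega>)
  case (0 \<omega>)
  let ?t = "bin_value (\<lambda>j. \<omega> (Suc j))"
  obtain i where "i \<ge> 1" "\<not> \<omega> i" using "0.prems" by blast
  then have "?t < 1" by (intro bin_value_less_1[where i = "i - 1"]) simp
  moreover have "0 \<le> ?t" by (rule bin_value_nonneg)
  ultimately have "\<lfloor>of_bool (\<omega> 0) + ?t\<rfloor> = of_bool (\<omega> 0)"
    by (intro floor_unique) auto
  moreover have "2 ^ Suc 0 * bin_value \<omega> = of_bool (\<omega> 0) + ?t"
    by (subst bin_value_unfold) simp
  ultimately show ?case by (simp add: bin_digit_def)
next
  case (Suc j \<omega>)
  let ?t = "bin_value (\<lambda>j. \<omega> (Suc j))"
  have "\<exists>j\<ge>m. \<not> \<omega> (Suc j)" for m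
    using Suc.prems[of "Suc m"] by (metis Suc_le_D Suc_le_mono)
  then have IH: "bin_digit (Suc j) ?t = of_bool (\<omega> (Suc j))"
    by (rule Suc.IH)
  \<comment> \<open>The leading digit contributes an even integer, which can be pulled out of the
    floor and does not change its parity.\<close>
  have "2 ^ Suc (Suc j) * bin_value \<omega> = of_int (2 ^ Suc j * of_bool (\<omega> 0)) + 2 ^ Suc j * ?t"
    by (subst bin_value_unfold) (simp add: algebra_simps)
  then have "\<lfloor>2 ^ Suc (Suc j) * bin_value \<omega>\<rfloor> = 2 ^ Suc j * of_bool (\<omega> 0) + \<lfloor>2 ^ Suc j * ?t\<rfloor>"
    by (simp only: int_add_floor[symmetric])
  then have "\<lfloor>2 ^ Suc (Suc j) * bin_value \<omega>\<rfloor> = 2 * (2 ^ j * of_bool (\<omega> 0)) + \<lfloor>2 ^ Suc j * ?t\<rfloor>"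
    by simp
  then have "\<lfloor>2 ^ Suc (Suc j) * bin_value \<omega>\<rfloor> mod 2 = \<lfloor>2 ^ Suc j * ?t\<rfloor> mod 2"
    by (metis mod_mult_self4)
  then show ?case using IH by (simp only: bin_digit_def)
qed

text \<open>This links cells to cylinders. By \<open>floor_double\<close> the next floor is made of
  the current one and a digit in \<open>{0, 1}\<close>, and both can be recovered from it.\<close>

lemma floor_eq_iff_bin_digits:
  fixes x y :: real
  assumes "\<lfloor>x\<rfloor> = \<lfloor>y\<rfloor>"
  shows "\<lfloor>2 ^ n * x\<rfloor> = \<lfloor>2 ^ n * y\<rfloor> \<longleftrightarrow> (\<forall>j<n. bin_digit (Suc j) x = bin_digit (Suc j) y)"
proof (induction n)
  case 0
  then show ?case using assms by simp
next
  case (Suc n)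
  have b: "bin_digit (Suc n) x < 2" for x
    unfolding bin_digit_def by (simp_all add: nat_less_iff)
  have "\<lfloor>2 ^ Suc n * x\<rfloor> = \<lfloor>2 ^ Suc n * y\<rfloor> \<longleftrightarrow>
      \<lfloor>2 ^ n * x\<rfloor> = \<lfloor>2 ^ n * y\<rfloor> \<and> bin_digit (Suc n) x = bin_digit (Suc n) y"
    unfolding floor_double using b[of x] b[of y] by presburger
  then show ?case using Suc.IH by (auto simp: less_Suc_eq)
qed

lemma bin_digit_le_1: "bin_digit j x \<le> 1"
  unfolding bin_digit_def by (simp add: nat_le_iff)

definition ones :: "nat \<Rightarrow> real \<Rightarrow> nat" where
  "ones n x = (\<Sum>j<n. bin_digit (Suc j) x)"

lemma ones_le: "ones n x \<le> n"
  unfolding ones_def using sum_bounded_above[of "{..<n}" "\<lambda>j. bin_digit (Suc j) x" 1] bin_digit_le_1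
  by simp

lemma digit_average_eq: "digit_average n x = real (ones n x) / real n"
proof -
  have "(\<Sum>j=1..n. real (bin_digit j x)) = (\<Sum>j<n. real (bin_digit (Suc j) x))"
    by (rule sum.reindex_bij_witness[of _ Suc "\<lambda>j. j - 1"]) auto
  then show ?thesis unfolding digit_average_def ones_def by simp
qed

text \<open>The Bernoulli weight of a cylinder depends on the digits only through the number of
  ones, which makes the empirical frequency the relevant statistic.\<close>

lemma prod_bin_digits:
  fixes p :: real
  shows "(\<Prod>j<n. if bin_digit (Suc j) x = 1 then p else 1 - p) = p ^ ones n x * (1 - p) ^ (n - ones n x)"
proof (induction n)
  case 0
  then show ?case by (simp add: ones_def)
next
  case (Suc n)
  have "bin_digit (Suc n) x = 1 \<or> bin_digit (Suc n) x = 0"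
    using bin_digit_le_1[of "Suc n" x] by linarith
  moreover have "ones (Suc n) x = ones n x + bin_digit (Suc n) x"
    by (simp add: ones_def)
  ultimately show ?case
    using Suc.IH ones_le[of n x] by (auto simp: Suc_diff_le)
qed

section \<open>Coin tossing\<close>

lemma prob_space_coin_space: "prob_space (coin_space p)"
  unfolding coin_space_def by (intro prob_space_PiM prob_space_measure_pmf)

lemma sets_coin_space [measurable_cong]:
  "sets (coin_space p) = sets (PiM UNIV (\<lambda>_. count_space UNIV))"
  unfolding coin_space_def by (intro sets_PiM_cong) auto

lemma space_coin_space: "space (coin_space p) = UNIV"
  by (simp add: coin_space_def space_PiM)

lemma distr_coin_component:
  "distr (coin_space p) (measure_pmf (bernoulli_pmf p)) (\<lambda>\<omega>. \<omega> i) = measure_pmf (bernoulli_pmf p)"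
  unfolding coin_space_def by (intro distr_PiM_component prob_space_measure_pmf) simp

text \<open>Independence means that the joint law is the product of the marginals; the joint law of
  all coordinates is the coin measure itself, which is such a product.\<close>

lemma indep_vars_coins:
  "prob_space.indep_vars (coin_space p) (\<lambda>_. measure_pmf (bernoulli_pmf p)) (\<lambda>i \<omega>. \<omega> i) UNIV"
proof -
  interpret prob_space "coin_space p" by (rule prob_space_coin_space)
  have m: "random_variable (measure_pmf (bernoulli_pmf p)) (\<lambda>\<omega>. \<omega> i)" for i :: nat
    unfolding coin_space_def by measurable
  show ?thesis
    using m
    by (subst indep_vars_iff_distr_eq_PiM')
      (auto simp: distr_coin_component restrict_UNIV, simp add: coin_space_def distr_id2)
qed

lemma coin_average_tendsto:
  assumes "p \<in> {0..1}"
  shows "AE \<omega> in coin_space p. (\<lambda>n. (\<Sum>i<n. of_bool (\<omega> i)) / real n) \<longlonglongrightarrow> p"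
proof -
  interpret prob_space "coin_space p" by (rule prob_space_coin_space)
  let ?X = "\<lambda>i \<omega>. of_bool (\<omega> i) :: real"
  have E: "expectation (?X i) = p" for i
  proof -
    have "expectation (?X i) = (\<integral>b. of_bool b \<partial>distr (coin_space p) (measure_pmf (bernoulli_pmf p)) (\<lambda>\<omega>. \<omega> i))"
      by (subst integral_distr) (auto simp: coin_space_def)
    also have "\<dots> = p"
      using assms by (simp add: distr_coin_component)
    finally show ?thesis .
  qed
  \<comment> \<open>Hoeffding's bound in the form \<open>2 * q ^ n\<close> makes the deviation
    probabilities summable as a geometric series. For \<open>n = 0\<close> it reads \<open>2\<close>
    and is trivial.\<close>
  have hoeff: "prob {\<omega>\<in>space (coin_space p). \<bar>(\<Sum>i<n. ?X i \<omega>) - real n * p\<bar> \<ge> real n * e}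
      \<le> 2 * exp (-2 * e\<^sup>2) ^ n" if "e > 0" for n e
  proof (cases "n = 0")
    case True
    then show ?thesis using prob_le_1 by (simp add: order.trans[OF prob_le_1])
  next
    case False
    interpret Hoeffding_ineq "coin_space p" "{..<n}" ?X "\<lambda>_. 0" "\<lambda>_. 1" "real n * p"
    proof unfold_locales
      show "indep_vars (\<lambda>_. borel) ?X {..<n}"
        by (rule indep_vars_compose2[OF indep_vars_subset[OF indep_vars_coins]]) auto
    qed (simp_all add: E)
    have "prob {\<omega>\<in>space (coin_space p). \<bar>(\<Sum>i<n. ?X i \<omega>) - real n * p\<bar> \<ge> real n * e}
      \<le> 2 * exp (-2 * (real n * e)\<^sup>2 / (\<Sum>i<n. (1 - 0)\<^sup>2))"
      using that False by (intro Hoeffding_ineq_abs_ge) auto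
    also have "-2 * (real n * e)\<^sup>2 / (\<Sum>i<n. (1 - 0)\<^sup>2) = real n * (-2 * e\<^sup>2)"
      using False by (simp add: power2_eq_square)
    finally show ?thesis by (simp only: exp_of_nat_mult)
  qed
  have "AE \<omega> in coin_space p. \<forall>\<^sub>F n in sequentially. \<bar>(\<Sum>i<n. ?X i \<omega>) - real n * p\<bar> < real n * e"
    if "e > 0" for e
  proof -
    have "AE \<omega> in coin_space p. \<forall>\<^sub>F n in sequentially. \<omega> \<in> space (coin_space p) -
       {\<omega>\<in>space (coin_space p). \<bar>(\<Sum>i<n. ?X i \<omega>) - real n * p\<bar> \<ge> real n * e}"
    proof (rule borel_cantelli_AE1)
      show "summable (\<lambda>n. prob {\<omega>\<in>space (coin_space p). \<bar>(\<Sum>i<n. ?X i \<omega>) - real n * p\<bar> \<ge> real n * e})"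
        by (rule summable_comparison_test'[where g = "\<lambda>n. 2 * exp (-2 * e\<^sup>2) ^ n"])
           (use hoeff[OF that] that in \<open>auto intro!: summable_mult summable_geometric\<close>)
    qed (auto simp: emeasure_eq_measure)
    then show ?thesis by eventually_elim (auto elim: eventually_mono)
  qed
  \<comment> \<open>Countably many tolerances \<open>1 / Suc m\<close> suffice and keep the
    exceptional set null.\<close>
  then have "AE \<omega> in coin_space p. \<forall>m. \<forall>\<^sub>F n in sequentially.
      \<bar>(\<Sum>i<n. ?X i \<omega>) - real n * p\<bar> < real n * (1 / Suc m)"
    by (subst AE_all_countable) (intro allI, simp only: of_nat_0_less_iff zero_less_Suc zero_less_divide_1_iff)
  then show ?thesis
  proof eventually_elim
    case (elim \<omega>)
    show ?case
    proof (rule tendstoI)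
      fix e :: real assume "e > 0"
      then obtain m where m: "1 / Suc m < e" using nat_approx_posE by (metis)
      show "\<forall>\<^sub>F n in sequentially. dist ((\<Sum>i<n. ?X i \<omega>) / real n) p < e"
        using elim[rule_format, of m] eventually_gt_at_top[of 0]
      proof eventually_elim
        case (elim n)
        have "\<bar>(\<Sum>i<n. ?X i \<omega>) / real n - p\<bar> = \<bar>(\<Sum>i<n. ?X i \<omega>) - real n * p\<bar> / real n"
          using \<open>0 < n\<close>
          by (simp add: abs_div_pos diff_divide_distrib del: sum_of_bool_eq)
        also have "\<dots> < 1 / Suc m"
          using elim by (simp add: divide_less_eq mult.commute)
        finally show ?case using m by (simp add: dist_real_def)
      qed
    qed
  qed
qed

text \<open>If all tosses from \<open>m\<close> on were ones, the averages would be at least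
  \<open>1 - m / n\<close>, and their limit \<open>p\<close> at least \<open>1\<close>.\<close>

lemma AE_coin_infinitely_many_zeros:
  assumes "0 \<le> p" "p < 1"
  shows "AE \<omega> in coin_space p. \<forall>m. \<exists>j\<ge>m. \<not> \<omega> j"
proof -
  have "\<exists>j\<ge>m. \<not> \<omega> j" if "(\<lambda>n. (\<Sum>i<n. of_bool (\<omega> i)) / real n) \<longlonglongrightarrow> p" for \<omega> m
  proof (rule ccontr)
    assume *: "\<not> (\<exists>j\<ge>m. \<not> \<omega> j)"
    have "1 \<le> p"
    proof (rule LIMSEQ_le[OF _ that])
      show "(\<lambda>n. 1 - real m / real n) \<longlonglongrightarrow> 1"
        using tendsto_diff[OF tendsto_const lim_const_over_n[of "real m"], of 1] by simp
      have "1 - real m / real n \<le> (\<Sum>i<n. of_bool (\<omega> i)) / real n" if "n \<ge> Suc m" for n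
      proof -
        have "real n - real m = (\<Sum>i\<in>{m..<n}. of_bool (\<omega> i))"
          using * that by simp
        also have "\<dots> \<le> (\<Sum>i<n. of_bool (\<omega> i))"
          by (intro sum_mono2) auto
        finally have "(real n - real m) / real n \<le> (\<Sum>i<n. of_bool (\<omega> i)) / real n"
          by (rule divide_right_mono) simp
        then show ?thesis using that by (simp add: diff_divide_distrib)
      qed
      then show "\<exists>N. \<forall>n\<ge>N. 1 - real m / real n \<le> (\<Sum>i<n. of_bool (\<omega> i)) / real n"
        by blast
    qed
    then show False using assms by simp
  qed
  then show ?thesis using coin_average_tendsto[of p] assms by (auto elim: eventually_mono)
qed

lemma measure_coin_cylinder:
  assumes "p \<in> {0..1}"
  shows "measure (coin_space p) {\<omega>. \<forall>j<n. \<omega> j = b j} = (\<Prod>j<n. if b j then p else 1 - p)"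
proof -
  interpret product_prob_space "\<lambda>_. measure_pmf (bernoulli_pmf p)" "UNIV :: nat set"
    by (intro product_prob_spaceI prob_space_measure_pmf)
  have "{\<omega>. \<forall>j<n. \<omega> j = b j} =
    prod_emb UNIV (\<lambda>_. measure_pmf (bernoulli_pmf p)) {..<n} (\<Pi>\<^sub>E j\<in>{..<n}. {b j})"
    unfolding prod_emb_def by (intro set_eqI) (simp add: PiE_iff Ball_def)
  then have "measure (coin_space p) {\<omega>. \<forall>j<n. \<omega> j = b j} =
    (\<Prod>j<n. measure (measure_pmf (bernoulli_pmf p)) {b j})"
    unfolding coin_space_def by (simp add: measure_PiM_emb)
  also have "\<dots> = (\<Prod>j<n. if b j then p else 1 - p)"
    using assms by (intro prod.cong refl) (simp add: measure_pmf_single)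
  finally show ?thesis .
qed

section \<open>Bernoulli measures\<close>

text \<open>Cells are indexed by all integers and cover the line, so that every one of them is
  half-open. On \<open>{0..<1}\<close> they agree with \<open>dyadic_interval\<close>, and the
  closed last interval causes no case distinction.\<close>

definition dcell :: "nat \<Rightarrow> int \<Rightarrow> real set" where
  "dcell n k = {x. \<lfloor>2 ^ n * x\<rfloor> = k}"

lemma dcell_measurable [measurable]: "dcell n k \<in> sets borel"
  unfolding dcell_def by measurable

lemma bernoulli_measure_eq: "bernoulli_measure p = distr (coin_space p) borel bin_value"
  unfolding bernoulli_measure_def bin_value_def ..

lemma measurable_bin_value [measurable]: "bin_value \<in> borel_measurable (coin_space p)"
  unfolding bin_value_def by measurable

lemma sets_bernoulli_measure [simp, measurable_cong]: "sets (bernoulli_measure p) = sets borel"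
  by (simp add: bernoulli_measure_eq)

lemma AE_bernoulli_measure_iff:
  assumes "Measurable.pred borel P"
  shows "(AE x in bernoulli_measure p. P x) \<longleftrightarrow> (AE \<omega> in coin_space p. P (bin_value \<omega>))"
  unfolding bernoulli_measure_eq using assms by (subst AE_distr_iff) (auto simp: pred_def)

lemma AE_bernoulli_measure_unit:
  assumes "0 \<le> p" "p < 1"
  shows "AE x in bernoulli_measure p. x \<in> {0..<1}"
proof (subst AE_bernoulli_measure_iff)
  show "AE \<omega> in coin_space p. bin_value \<omega> \<in> {0..<1}"
    using AE_coin_infinitely_many_zeros[OF assms]
    by eventually_elim (use bin_value_nonneg bin_value_less_1 in auto)
qed measurable

lemma ones_bin_value:
  assumes "\<forall>m. \<exists>j\<ge>m. \<not> \<omega> j"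
  shows "real (ones n (bin_value \<omega>)) = (\<Sum>i<n. of_bool (\<omega> i))"
  unfolding ones_def using bin_digit_bin_value assms by simp

lemma measurable_bin_digit [measurable]: "(\<lambda>x. bin_digit j x) \<in> measurable borel (count_space UNIV)"
  unfolding bin_digit_def by measurable

lemma measurable_digit_average [measurable]: "digit_average n \<in> borel_measurable borel"
  unfolding digit_average_def by measurable

lemma AE_bernoulli_measure_digit_average:
  assumes "0 \<le> p" "p < 1"
  shows "AE x in bernoulli_measure p. (\<lambda>n. digit_average n x) \<longlonglongrightarrow> p"
proof (subst AE_bernoulli_measure_iff)
  show "AE \<omega> in coin_space p. (\<lambda>n. digit_average n (bin_value \<omega>)) \<longlonglongrightarrow> p"
    using AE_coin_infinitely_many_zeros[OF assms] coin_average_tendsto[of p] assms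
    by (auto simp: digit_average_eq ones_bin_value)
qed measurable

text \<open>Up to a null set, the preimage of the cell in coin space is the cylinder that prescribes
  the first \<open>n\<close> digits of \<open>x\<close>; the exceptional sequences end in
  ones.\<close>

lemma measure_bernoulli_dcell:
  assumes "0 \<le> p" "p < 1" "x \<in> {0..<1}"
  shows "measure (bernoulli_measure p) (dcell n \<lfloor>2 ^ n * x\<rfloor>) = p ^ ones n x * (1 - p) ^ (n - ones n x)"
proof -
  interpret prob_space "coin_space p" by (rule prob_space_coin_space)
  let ?b = "\<lambda>j. bin_digit (Suc j) x = 1"
  have "measure (bernoulli_measure p) (dcell n \<lfloor>2 ^ n * x\<rfloor>) =
      measure (coin_space p) (bin_value -` dcell n \<lfloor>2 ^ n * x\<rfloor> \<inter> space (coin_space p))"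
    unfolding bernoulli_measure_eq by (rule measure_distr) auto
  also have "\<dots> = measure (coin_space p) {\<omega>. \<forall>j<n. \<omega> j = ?b j}"
  proof (rule measure_eq_AE)
    show "AE \<omega> in coin_space p. \<omega> \<in> bin_value -` dcell n \<lfloor>2 ^ n * x\<rfloor> \<inter> space (coin_space p) \<longleftrightarrow>
      \<omega> \<in> {\<omega>. \<forall>j<n. \<omega> j = ?b j}"
      using AE_coin_infinitely_many_zeros[OF assms(1,2)]
    proof eventually_elim
      case (elim \<omega>)
      obtain i where "\<not> \<omega> i" using elim by blast
      then have "\<lfloor>bin_value \<omega>\<rfloor> = \<lfloor>x\<rfloor>"
        using bin_value_nonneg[of \<omega>] bin_value_less_1[of \<omega> i] assms(3) by (simp add: floor_unique[of 0])
      then have "bin_value \<omega> \<in> dcell n \<lfloor>2 ^ n * x\<rfloor> \<longleftrightarrow> (\<forall>j<n. of_bool (\<omega> j) = bin_digit (Suc j) x)"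
        by (simp only: dcell_def mem_Collect_eq floor_eq_iff_bin_digits
            bin_digit_bin_value[OF elim[rule_format]] of_nat_of_bool)
      moreover have "of_bool (\<omega> j) = bin_digit (Suc j) x \<longleftrightarrow> \<omega> j = ?b j" for j
        using bin_digit_le_1[of "Suc j" x] by (cases "\<omega> j") auto
      ultimately show ?case
        by (simp add: space_coin_space)
    qed
    show "{\<omega>. \<forall>j<n. \<omega> j = ?b j} \<in> sets (coin_space p)"
    proof -
      have "{\<omega>\<in>space (coin_space p). \<forall>j<n. \<omega> j = ?b j} \<in> sets (coin_space p)"
        by measurable
      then show ?thesis by (simp add: space_coin_space)
    qed
  qed measurable
  also have "\<dots> = p ^ ones n x * (1 - p) ^ (n - ones n x)"
    using assms by (subst measure_coin_cylinder) (simp_all only: prod_bin_digits, simp)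
  finally show ?thesis .
qed

section \<open>Counting heavy levels\<close>

text \<open>Eventually \<open>m n < 2 powr (- c * n)\<close>, so late levels above the threshold
  satisfy \<open>j \<le> T / c\<close>. The cutoff \<open>j0\<close> is chosen before
  \<open>T\<close>, so it is negligible as \<open>T\<close> grows.\<close>

lemma card_level_set_upper:
  fixes m :: "nat \<Rightarrow> real"
  assumes lim: "(\<lambda>n. - log 2 (m n) / real n) \<longlonglongrightarrow> s" and c: "0 < c" "c < s"
  obtains j0 where
    "\<forall>T. {j. 2 powr (- T) \<le> m j} \<subseteq> {..<j0} \<union> {j. real j \<le> T / c}"
proof -
  have "\<forall>\<^sub>F n in sequentially. c < - log 2 (m n) / real n \<and> 0 < n"
    using order_tendstoD(1)[OF lim c(2)] eventually_gt_at_top[of 0] by eventually_elim simp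
  then obtain j0 where j0: "\<And>n. n \<ge> j0 \<Longrightarrow> c < - log 2 (m n) / real n \<and> 0 < n"
    unfolding eventually_sequentially by blast
  have "real j \<le> T / c" if "2 powr (- T) \<le> m j" "j \<ge> j0" for T j
  proof -
    have "0 < m j" using that(1) by (rule less_le_trans[rotated]) simp
    then have "- T \<le> log 2 (m j)" using that(1) by (simp add: le_log_iff)
    moreover have "c * real j < - log 2 (m j)" using j0[OF that(2)] pos_less_divide_eq[of "real j" c "- log 2 (m j)"] by simp
    ultimately show ?thesis using c by (simp add: field_simps)
  qed
  then show ?thesis by (intro that[of j0]) force
qed

lemma finite_level_set:
  fixes m :: "nat \<Rightarrow> real"
  assumes "(\<lambda>n. - log 2 (m n) / real n) \<longlonglongrightarrow> s" "0 < s"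
  shows "finite {j. 2 powr (- T) \<le> m j}"
proof -
  obtain j0 where "{j. 2 powr (- T) \<le> m j} \<subseteq> {..<j0} \<union> {j. real j \<le> T / (s / 2)}"
    using card_level_set_upper[OF assms(1), of "s / 2"] assms(2) by (metis field_sum_of_halves half_gt_zero less_add_same_cancel1)
  moreover have "{j. real j \<le> T / (s / 2)} \<subseteq> {..nat \<lfloor>T / (s / 2)\<rfloor>}"
    by (auto simp: le_nat_floor)
  ultimately show ?thesis by (meson finite_Un finite_atMost finite_lessThan finite_subset)
qed

lemma card_le_real:
  assumes "0 \<le> r"
  shows "real (card {j. real j \<le> r}) \<le> r + 1" "r \<le> real (card {j. real j \<le> r})"
proof -
  have "{j. real j \<le> r} = {..nat \<lfloor>r\<rfloor>}"
    using assms by (auto simp: le_nat_floor) linarith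
  then have "real (card {j. real j \<le> r}) = real_of_int \<lfloor>r\<rfloor> + 1"
    using assms by simp
  then show "real (card {j. real j \<le> r}) \<le> r + 1" "r \<le> real (card {j. real j \<le> r})"
    by linarith+
qed

text \<open>If \<open>m n\<close> is about \<open>2 powr (- s * n)\<close>, it falls below
  \<open>2 powr (- T)\<close> near level \<open>T / s\<close>. Constants \<open>c\<close> slightly
  below and above \<open>s\<close> make this precise up to \<open>j0\<close> levels, which disappear
  after division by \<open>T\<close>.\<close>

lemma card_level_set_tendsto:
  fixes m :: "nat \<Rightarrow> real"
  assumes nonneg: "\<And>n. 0 \<le> m n"
    and lim: "(\<lambda>n. - log 2 (m n) / real n) \<longlonglongrightarrow> s" and s: "0 < s"
  shows "((\<lambda>T. real (card {j. 2 powr (- T) \<le> m j}) / T) \<longlongrightarrow> 1 / s) at_top"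
proof (rule order_tendstoI)
  fix hi assume hi: "1 / s < hi"
  have "0 < hi" using s hi by (meson divide_pos_pos less_trans zero_less_one)
  then obtain c where c: "1 / hi < c" "c < s"
    using dense[of "1 / hi" s] hi s by (auto simp: field_simps)
  have "0 < c" using c \<open>0 < hi\<close> by (meson divide_pos_pos less_trans zero_less_one)
  obtain j0 where j0: "\<forall>T. {j. 2 powr (- T) \<le> m j} \<subseteq> {..<j0} \<union> {j. real j \<le> T / c}"
    using card_level_set_upper[OF lim \<open>0 < c\<close> c(2)] .
  have b: "real (card {j. 2 powr (- T) \<le> m j}) / T \<le> 1 / c + (j0 + 1) / T" if "T > 0" for T
  proof -
    have "{j. real j \<le> T / c} \<subseteq> {..nat \<lfloor>T / c\<rfloor>}"
      by (auto simp: le_nat_floor)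
    then have "finite {j. real j \<le> T / c}" by (rule finite_subset) simp
    then have "card {j. 2 powr (- T) \<le> m j} \<le> card ({..<j0} \<union> {j. real j \<le> T / c})"
      using j0 by (intro card_mono) auto
    also have "\<dots> \<le> j0 + card {j. real j \<le> T / c}"
      using card_Un_le[of "{..<j0}" "{j. real j \<le> T / c}"] by simp
    finally have "real (card {j. 2 powr (- T) \<le> m j}) \<le> T / c + (j0 + 1)"
      using card_le_real(1)[of "T / c"] that \<open>0 < c\<close> by simp
    then show ?thesis using that by (simp add: field_simps)
  qed
  have "((\<lambda>T. 1 / c + (j0 + 1) / T) \<longlongrightarrow> 1 / c) at_top" by real_asymp
  moreover have "1 / c < hi" using c(1) \<open>0 < c\<close> \<open>0 < hi\<close> by (simp add: field_simps)
  ultimately have "\<forall>\<^sub>F T in at_top. 1 / c + (j0 + 1) / T < hi" by (rule order_tendstoD)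
  then show "\<forall>\<^sub>F T in at_top. real (card {j. 2 powr (- T) \<le> m j}) / T < hi"
    using eventually_gt_at_top[of 0] by eventually_elim (use b in \<open>force intro: le_less_trans\<close>)
next
  fix lo assume lo: "lo < 1 / s"
  obtain c where c: "s < c" "lo < 1 / c"
  proof (cases "lo \<le> 0")
    case True
    then show ?thesis using that[of "s + 1"] s by (smt (verit) divide_pos_pos)
  next
    case False
    then have "s < 1 / lo" using lo s by (simp add: field_simps)
    then obtain c where "s < c" "c < 1 / lo" using dense by blast
    then show ?thesis using that[of c] s False by (simp add: field_simps)
  qed
  have "\<forall>\<^sub>F n in sequentially. - log 2 (m n) / real n < c \<and> 0 < - log 2 (m n) / real n \<and> 0 < n"
    using order_tendstoD(2)[OF lim c(1)] order_tendstoD(1)[OF lim s] eventually_gt_at_top[of 0]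
    by eventually_elim simp
  then obtain j0 where j0: "\<And>n. n \<ge> j0 \<Longrightarrow> - log 2 (m n) / real n < c \<and> 0 < - log 2 (m n) / real n \<and> 0 < n"
    unfolding eventually_sequentially by blast
  have b: "1 / c - j0 / T \<le> real (card {j. 2 powr (- T) \<le> m j}) / T" if "T > 0" for T
  proof -
    have "{j. real j \<le> T / c} \<subseteq> {..<j0} \<union> {j. 2 powr (- T) \<le> m j}"
    proof (rule subsetI, rule ccontr)
      fix j assume j: "j \<in> {j. real j \<le> T / c}" "j \<notin> {..<j0} \<union> {j. 2 powr (- T) \<le> m j}"
      then have g: "- log 2 (m j) / real j < c" "0 < - log 2 (m j) / real j" "0 < j"
        using j0[of j] by auto
      show False
      proof (cases "0 < m j")
        case True
        have "- log 2 (m j) < c * real j" using g by (simp add: field_simps)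
        also have "\<dots> \<le> T" using j(1) c s by (simp add: field_simps)
        finally have "2 powr (- T) \<le> m j" using True by (subst le_log_iff[symmetric]) auto
        then show False using j(2) by simp
      next
        case False
        \<comment> \<open>Here \<open>log 2 0 = 0\<close> would make the quotient zero, which the
          positivity in the choice of \<open>j0\<close> rules out.\<close>
        then have "m j = 0" using nonneg[of j] by simp
        then show False using g(2) by (simp add: log_def)
      qed
    qed
    then have "card {j. real j \<le> T / c} \<le> card ({..<j0} \<union> {j. 2 powr (- T) \<le> m j})"
      by (intro card_mono) (simp_all add: finite_level_set[OF lim s])
    also have "\<dots> \<le> j0 + card {j. 2 powr (- T) \<le> m j}"
      using card_Un_le[of "{..<j0}" "{j. 2 powr (- T) \<le> m j}"] by simp
    finally have "T / c \<le> j0 + real (card {j. 2 powr (- T) \<le> m j})"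
      using card_le_real(2)[of "T / c"] that c s by simp
    then have "(T / c) / T \<le> (j0 + real (card {j. 2 powr (- T) \<le> m j})) / T"
      by (rule divide_right_mono) (use that in simp)
    then show ?thesis using that by (simp add: add_divide_distrib)
  qed
  have "((\<lambda>T. 1 / c - j0 / T) \<longlongrightarrow> 1 / c) at_top" by real_asymp
  then have "\<forall>\<^sub>F T in at_top. lo < 1 / c - j0 / T" by (rule order_tendstoD) (rule c(2))
  then show "\<forall>\<^sub>F T in at_top. lo < real (card {j. 2 powr (- T) \<le> m j}) / T"
    using eventually_gt_at_top[of 0] by eventually_elim (use b in \<open>force intro: less_le_trans\<close>)
qed


text \<open>Isolates what the quantization argument uses: an exponential upper bound for all cell
  masses and a positive dyadic local dimension, which may vary from point to point.\<close>

locale dyadic_local_dim = prob_space \<nu> for \<nu> :: "real measure" +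
  fixes a :: real and s :: "real \<Rightarrow> real"
  assumes sets_eq_borel [simp, measurable_cong]: "sets \<nu> = sets borel"
    and AE_unit: "AE x in \<nu>. x \<in> {0..<1}"
    and a_pos: "0 < a"
    and frostman: "\<And>n k. measure \<nu> (dcell n k) \<le> 2 powr (- a * real n)"
    and s_measurable [measurable]: "s \<in> borel_measurable borel"
    and AE_s_pos: "AE x in \<nu>. 0 < s x"
    and AE_local_dim:
      "AE x in \<nu>. (\<lambda>n. - log 2 (measure \<nu> (dcell n \<lfloor>2 ^ n * x\<rfloor>)) / real n) \<longlonglongrightarrow> s x"
begin

lemma space_eq [simp]: "space \<nu> = UNIV"
  using sets_eq_imp_space_eq[OF sets_eq_borel] by simp

definition mass :: "nat \<Rightarrow> real \<Rightarrow> real" where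
  "mass n x = measure \<nu> (dcell n \<lfloor>2 ^ n * x\<rfloor>)"

text \<open>This is \<open>c T x\<close>. The set is finite by \<open>heavy_level_le\<close>; for an
  infinite set \<open>card\<close> would be \<open>0\<close>.\<close>

definition heavy_levels :: "real \<Rightarrow> real \<Rightarrow> nat" where
  "heavy_levels T x = card {j. 2 powr (- T) \<le> mass j x}"

definition mean_level :: "real \<Rightarrow> real" where
  "mean_level T = (\<integral>x. real (heavy_levels T x) \<partial>\<nu>)"

lemma mass_measurable [measurable]: "mass n \<in> borel_measurable borel"
proof -
  have "(\<lambda>k. measure \<nu> (dcell n k)) \<in> measurable (count_space UNIV) borel" by simp
  then show ?thesis unfolding mass_def by measurable
qed

lemma heavy_level_le:
  assumes "2 powr (- T) \<le> mass j x"
  shows "real j \<le> T / a"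
proof -
  have "2 powr (- T) \<le> 2 powr (- a * real j)"
    using assms frostman[of j "\<lfloor>2 ^ j * x\<rfloor>"] unfolding mass_def by linarith
  then show ?thesis using a_pos by (simp add: field_simps)
qed

text \<open>No level above \<open>T / a\<close> is heavy, so the count is a finite sum of
  indicators. Measurability and the comparison of integrals rest on this form.\<close>

lemma heavy_levels_eq_sum:
  assumes "T / a < real J"
  shows "real (heavy_levels T x) = (\<Sum>j<J. indicator {x. 2 powr (- T) \<le> mass j x} x)"
proof -
  have "{j. 2 powr (- T) \<le> mass j x} = {j\<in>{..<J}. 2 powr (- T) \<le> mass j x}"
    using heavy_level_le[of T _ x] assms by fastforce
  then have "heavy_levels T x = card {j\<in>{..<J}. 2 powr (- T) \<le> mass j x}"
    unfolding heavy_levels_def by simp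
  also have "real \<dots> = (\<Sum>j<J. indicator {x. 2 powr (- T) \<le> mass j x} x)"
    by (simp add: indicator_def of_bool_def sum.If_cases Int_def)
  finally show ?thesis .
qed

lemma heavy_levels_measurable [measurable]: "(\<lambda>x. real (heavy_levels T x)) \<in> borel_measurable borel"
proof -
  obtain J where "T / a < real J" using reals_Archimedean2 by blast
  then show ?thesis by (subst heavy_levels_eq_sum) measurable
qed

lemma heavy_levels_le:
  assumes "0 \<le> T"
  shows "real (heavy_levels T x) \<le> T / a + 1"
proof -
  have "0 \<le> T / a" using assms a_pos by simp
  moreover have "{j. real j \<le> T / a} \<subseteq> {..nat \<lfloor>T / a\<rfloor>}"
    by (auto simp: le_nat_floor)
  then have "finite {j. real j \<le> T / a}" by (rule finite_subset) simp
  then have "heavy_levels T x \<le> card {j. real j \<le> T / a}"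
    unfolding heavy_levels_def using heavy_level_le by (intro card_mono) auto
  ultimately show ?thesis using card_le_real(1)[of "T / a"] by simp
qed

lemma integrable_heavy_levels:
  assumes "0 \<le> T"
  shows "integrable \<nu> (\<lambda>x. real (heavy_levels T x))"
  using heavy_levels_le[OF assms] by (intro integrable_const_bound[where B = "T / a + 1"]) auto

text \<open>The Frostman bound passes to the limit and gives \<open>a \<le> s x\<close>, so that
  \<open>1 / s\<close> is integrable. Positivity of the limit eventually excludes mass
  \<open>0\<close>, where the logarithm defaults to \<open>0\<close>.\<close>

lemma AE_inverse_s_le: "AE x in \<nu>. norm (1 / s x) \<le> 1 / a"
  using AE_s_pos AE_local_dim
proof eventually_elim
  case (elim x)
  have "a \<le> s x"
  proof (rule LIMSEQ_le_const[OF elim(2)])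
    have "a \<le> - log 2 (mass n x) / real n"
      if "n > 0" "0 < - log 2 (mass n x) / real n" for n
    proof -
      have "mass n x \<noteq> 0" using that(2) by (auto simp: log_def)
      then have "0 < mass n x" by (simp add: mass_def less_le)
      then have "log 2 (mass n x) \<le> - a * real n"
        using frostman[of n "\<lfloor>2 ^ n * x\<rfloor>"] by (simp add: log_le_iff mass_def)
      then show ?thesis using that(1) by (simp add: field_simps)
    qed
    moreover have "\<forall>\<^sub>F n in sequentially. n > 0 \<and> 0 < - log 2 (mass n x) / real n"
      using order_tendstoD(1)[OF elim(2,1)] eventually_gt_at_top[of 0] unfolding mass_def
      by eventually_elim simp
    ultimately have "\<forall>\<^sub>F n in sequentially. a \<le> - log 2 (mass n x) / real n"
      by (auto elim: eventually_mono)
    then show "\<exists>N. \<forall>n\<ge>N. a \<le> - log 2 (measure \<nu> (dcell n \<lfloor>2 ^ n * x\<rfloor>)) / real n"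
      unfolding mass_def eventually_sequentially .
  qed
  then show ?case using elim(1) a_pos by (simp add: frac_le)
qed

text \<open>Dominated convergence: \<open>card_level_set_tendsto\<close> gives the pointwise limit
  and \<open>heavy_levels_le\<close> the constant majorant \<open>1 / a + 1\<close> for
  \<open>T \<ge> 1\<close>.\<close>

lemma mean_level_tendsto: "((\<lambda>T. mean_level T / T) \<longlongrightarrow> (\<integral>x. 1 / s x \<partial>\<nu>)) at_top"
proof -
  have "((\<lambda>T. \<integral>x. real (heavy_levels T x) / T \<partial>\<nu>) \<longlongrightarrow> (\<integral>x. 1 / s x \<partial>\<nu>)) at_top"
  proof (rule integral_dominated_convergence_at_top)
    show "\<forall>\<^sub>F T in at_top. AE x in \<nu>. norm (real (heavy_levels T x) / T) \<le> 1 / a + 1"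
      using eventually_ge_at_top[of 1]
    proof eventually_elim
      case (elim T)
      have "real (heavy_levels T x) / T \<le> 1 / a + 1" for x
      proof -
        have "real (heavy_levels T x) / T \<le> (T / a + 1) / T"
          using heavy_levels_le[of T x] elim by (intro divide_right_mono) auto
        also have "\<dots> \<le> 1 / a + 1" using elim a_pos by (simp add: field_simps)
        finally show ?thesis .
      qed
      then show ?case using elim by simp
    qed
    show "AE x in \<nu>. ((\<lambda>T. real (heavy_levels T x) / T) \<longlongrightarrow> 1 / s x) at_top"
      using AE_s_pos AE_local_dim
      by eventually_elim (auto intro!: card_level_set_tendsto simp: heavy_levels_def mass_def)
  qed simp_all
  then show ?thesis by (simp add: mean_level_def)
qed

text \<open>Allows the final limit to be inverted. A nonnegative integrand with integral
  \<open>0\<close> vanishes almost everywhere, contrary to \<open>1 / s > 0\<close>.\<close>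

lemma integral_inverse_s_pos: "0 < (\<integral>x. 1 / s x \<partial>\<nu>)"
proof -
  have int: "integrable \<nu> (\<lambda>x. 1 / s x)"
    using AE_inverse_s_le by (intro integrable_const_bound[where B = "1 / a"]) auto
  have nn: "AE x in \<nu>. 0 \<le> 1 / s x"
    using AE_s_pos by eventually_elim simp
  have "\<not> (AE x in \<nu>. 1 / s x = 0)"
  proof
    assume "AE x in \<nu>. 1 / s x = 0"
    then have "AE x in \<nu>. False" using AE_s_pos by eventually_elim simp
    then show False by simp
  qed
  then show ?thesis
    using integral_nonneg_eq_0_iff_AE[OF int nn] integral_nonneg_AE[OF nn] by linarith
qed

end

section \<open>Quantization error\<close>

lemma infdist_finite_le_iff:
  fixes x :: real
  assumes "finite A" "A \<noteq> {}"
  shows "infdist x A \<le> r \<longleftrightarrow> (\<exists>y\<in>A. \<bar>x - y\<bar> \<le> r)"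
proof
  assume "infdist x A \<le> r"
  moreover obtain y where "y \<in> A" "infdist x A = dist x y"
    using infdist_attains_inf[OF finite_imp_closed[OF assms(1)] assms(2)] .
  ultimately show "\<exists>y\<in>A. \<bar>x - y\<bar> \<le> r" by (auto simp: dist_real_def)
next
  assume "\<exists>y\<in>A. \<bar>x - y\<bar> \<le> r"
  then show "infdist x A \<le> r" by (auto simp: dist_real_def intro: infdist_le2)
qed

text \<open>Layer cake in base 2: for \<open>0 < d \<le> 1\<close> at least \<open>- log 2 d\<close>
  levels \<open>j\<close> satisfy \<open>d \<le> 2 powr (- j)\<close>. For \<open>d \<le> 0\<close>
  both sides are infinite, and for \<open>d > 1\<close> the left side is truncated to
  \<open>0\<close>.\<close>

lemma neg_ext_ln_le_suminf:
  "e2ennreal (- ext_ln d) \<le> ennreal (ln 2) * (\<Sum>j. indicator {j. d \<le> 2 powr (- real j)} j)"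
proof (cases "d \<le> 0")
  case True
  then have "d \<le> 2 powr (- real j)" for j by (rule order.trans) simp
  then have "(\<Sum>j. indicator {j. d \<le> 2 powr (- real j)} j :: ennreal) = (\<Sum>j::nat. 1)"
    by simp
  also have "\<dots> = \<top>"
    by (simp add: nn_integral_count_space_nat[symmetric])
  finally show ?thesis by (simp add: ennreal_mult_top)
next
  case False
  define g where "g = - log 2 d"
  have g: "- ln d = ln 2 * g" by (simp add: g_def log_def)
  show ?thesis
  proof (cases "0 \<le> g")
    case True
    have "{j. real j \<le> g} = {j. d \<le> 2 powr (- real j)}"
      using False by (auto simp: g_def log_le_iff[symmetric] simp del: log_le_iff)
    have "e2ennreal (- ext_ln d) = ennreal (ln 2 * g)"
      using False by (simp add: ext_ln_def g)
    also have "\<dots> = ennreal (ln 2) * ennreal g" using True by (simp add: ennreal_mult)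
    also have "ennreal g \<le> (\<Sum>j\<in>{j. real j \<le> g}. 1)"
      using card_le_real(2)[OF True] by (simp add: ennreal_of_nat_eq_real_of_nat)
    also have "\<dots> = (\<Sum>j\<in>{j. real j \<le> g}. indicator {j. d \<le> 2 powr (- real j)} j)"
      using \<open>{j. real j \<le> g} = _\<close> by simp
    also have "\<dots> \<le> (\<Sum>j. indicator {j. d \<le> 2 powr (- real j)} j)"
    proof (rule sum_le_suminf)
      have "{j. real j \<le> g} \<subseteq> {..nat \<lfloor>g\<rfloor>}" by (auto simp: le_nat_floor)
      then show "finite {j. real j \<le> g}" by (rule finite_subset) simp
    qed simp_all
    finally show ?thesis by (simp add: mult_left_mono)
  next
    case neg: False
    then have "ln 2 * g \<le> 0" by (simp add: mult_nonneg_nonpos)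
    then show ?thesis using False by (simp add: ext_ln_def g ennreal_neg)
  qed
qed

text \<open>If \<open>x\<close> and \<open>y\<close> are within \<open>2 powr (- j)\<close>, then
  \<open>2 ^ j * x\<close> and \<open>2 ^ j * y\<close> differ by at most \<open>1\<close>, and so
  do their floors. Hence the cell of \<open>y\<close> and its two neighbours cover all points that
  close to \<open>y\<close>.\<close>

definition near_cells :: "nat \<Rightarrow> real set \<Rightarrow> int set" where
  "near_cells j A = (\<Union>y\<in>A. {\<lfloor>2 ^ j * y\<rfloor> - 1 .. \<lfloor>2 ^ j * y\<rfloor> + 1})"

lemma card_near_cells:
  assumes "finite A"
  shows "finite (near_cells j A)" "card (near_cells j A) \<le> 3 * card A"
proof -
  show "finite (near_cells j A)" unfolding near_cells_def using assms by simp
  have "card (near_cells j A) \<le> (\<Sum>y\<in>A. card {\<lfloor>2 ^ j * y\<rfloor> - 1 .. \<lfloor>2 ^ j * y\<rfloor> + 1})"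
    unfolding near_cells_def by (rule card_UN_le[OF assms])
  then show "card (near_cells j A) \<le> 3 * card A" by simp
qed

lemma near_subset:
  assumes "finite A" "A \<noteq> {}" "infdist x A \<le> 2 powr (- real j)"
  shows "x \<in> dcell j \<lfloor>2 ^ j * x\<rfloor>" "\<lfloor>2 ^ j * x\<rfloor> \<in> near_cells j A"
proof -
  obtain y where y: "y \<in> A" "\<bar>x - y\<bar> \<le> 2 powr (- real j)"
    using assms by (auto simp: infdist_finite_le_iff)
  have "\<bar>2 ^ j * x - 2 ^ j * y\<bar> = 2 ^ j * \<bar>x - y\<bar>"
    by (simp add: abs_mult flip: right_diff_distrib)
  also have "\<dots> \<le> 2 ^ j * 2 powr (- real j)" using y(2) by simp
  also have "\<dots> = 1" by (simp add: powr_minus powr_realpow)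
  finally have "\<lfloor>2 ^ j * x\<rfloor> \<in> {\<lfloor>2 ^ j * y\<rfloor> - 1 .. \<lfloor>2 ^ j * y\<rfloor> + 1}"
    unfolding atLeastAtMost_iff by linarith
  then show "\<lfloor>2 ^ j * x\<rfloor> \<in> near_cells j A" using y(1) by (auto simp: near_cells_def)
  show "x \<in> dcell j \<lfloor>2 ^ j * x\<rfloor>" by (simp add: dcell_def)
qed

lemma infdist_measurable [measurable]: "(\<lambda>x. infdist x A) \<in> borel_measurable borel" for A :: "real set"
  by (intro borel_measurable_continuous_onI continuous_intros)

lemma ext_exp_mono: "x \<le> y \<Longrightarrow> ext_exp x \<le> ext_exp y"
  unfolding ext_exp_def by (cases x; cases y) auto

section \<open>Lower bound for the error of an arbitrary finite set\<close>

context dyadic_local_dim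
begin

text \<open>Covers the neighbourhood by at most \<open>3 * N\<close> cells. The bound is summable in
  \<open>j\<close> and serves for the levels from \<open>J\<close> on.\<close>

lemma measure_near_le_frostman:
  assumes "finite A" "A \<noteq> {}" "card A \<le> N"
  shows "measure \<nu> {x. infdist x A \<le> 2 powr (- real j)} \<le> 3 * real N * 2 powr (- a * real j)"
proof -
  have "measure \<nu> {x. infdist x A \<le> 2 powr (- real j)} \<le> measure \<nu> (\<Union>k\<in>near_cells j A. dcell j k)"
    using near_subset[OF assms(1,2)] card_near_cells(1)[OF assms(1)]
    by (intro finite_measure_mono subsetI) (blast, auto intro!: sets.finite_UN)
  also have "\<dots> \<le> (\<Sum>k\<in>near_cells j A. measure \<nu> (dcell j k))"
    using card_near_cells(1)[OF assms(1)] by (intro measure_UNION_le) auto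
  also have "\<dots> \<le> (\<Sum>k\<in>near_cells j A. 2 powr (- a * real j))"
    by (intro sum_mono frostman)
  also have "\<dots> = real (card (near_cells j A)) * 2 powr (- a * real j)" by simp
  also have "\<dots> \<le> 3 * real N * 2 powr (- a * real j)"
    using card_near_cells(2)[OF assms(1), of j] assms(3) by (intro mult_right_mono) auto
  finally show ?thesis .
qed

text \<open>A point near \<open>A\<close> lies either in a heavy cell or in one of at most
  \<open>3 * N\<close> light cells, each of mass below \<open>2 powr (- T)\<close>. This serves for
  the levels below \<open>J\<close>.\<close>

lemma measure_near_le_heavy:
  assumes "finite A" "A \<noteq> {}" "card A \<le> N"
  shows "measure \<nu> {x. infdist x A \<le> 2 powr (- real j)} \<le>
     measure \<nu> {x. 2 powr (- T) \<le> mass j x} + 3 * real N * 2 powr (- T)"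
proof -
  let ?K = "{k\<in>near_cells j A. measure \<nu> (dcell j k) < 2 powr (- T)}"
  have fin: "finite ?K" using card_near_cells(1)[OF assms(1)] by simp
  have "measure \<nu> {x. infdist x A \<le> 2 powr (- real j)} \<le>
      measure \<nu> ({x. 2 powr (- T) \<le> mass j x} \<union> (\<Union>k\<in>?K. dcell j k))"
  proof (intro finite_measure_mono subsetI)
    fix x assume "x \<in> {x. infdist x A \<le> 2 powr (- real j)}"
    then have "infdist x A \<le> 2 powr (- real j)" by simp
    from near_subset[OF assms(1,2) this]
    show "x \<in> {x. 2 powr (- T) \<le> mass j x} \<union> (\<Union>k\<in>?K. dcell j k)"
      by (cases "2 powr (- T) \<le> mass j x") (auto simp: mass_def)
  next
    have "(\<Union>k\<in>?K. dcell j k) \<in> sets borel"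
      using fin by (intro sets.finite_UN) auto
    moreover have "{x. 2 powr (- T) \<le> mass j x} \<in> sets borel" by measurable
    ultimately show "{x. 2 powr (- T) \<le> mass j x} \<union> (\<Union>k\<in>?K. dcell j k) \<in> sets \<nu>" by simp
  qed
  also have "\<dots> \<le> measure \<nu> {x. 2 powr (- T) \<le> mass j x} + measure \<nu> (\<Union>k\<in>?K. dcell j k)"
    using fin by (intro measure_Un_le) (auto intro!: sets.finite_UN)
  also have "measure \<nu> (\<Union>k\<in>?K. dcell j k) \<le> (\<Sum>k\<in>?K. measure \<nu> (dcell j k))"
    using fin by (intro measure_UNION_le) auto
  also have "\<dots> \<le> (\<Sum>k\<in>?K. 2 powr (- T))"
    by (intro sum_mono) auto
  also have "\<dots> = real (card ?K) * 2 powr (- T)" by simp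
  also have "\<dots> \<le> 3 * real N * 2 powr (- T)"
  proof (intro mult_right_mono)
    have "card ?K \<le> card (near_cells j A)"
      by (intro card_mono card_near_cells(1)[OF assms(1)]) auto
    then show "real (card ?K) \<le> 3 * real N" using card_near_cells(2)[OF assms(1), of j] assms(3) by linarith
  qed simp
  finally show ?thesis by simp
qed

lemma sum_measure_heavy_le:
  assumes "0 \<le> T"
  shows "(\<Sum>j<J. measure \<nu> {x. 2 powr (- T) \<le> mass j x}) \<le> mean_level T"
proof -
  have "(\<Sum>j<J. measure \<nu> {x. 2 powr (- T) \<le> mass j x}) =
      (\<integral>x. (\<Sum>j<J. indicator {x. 2 powr (- T) \<le> mass j x} x) \<partial>\<nu>)"
    by (subst Bochner_Integration.integral_sum) (auto simp: emeasure_eq_measure)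
  also have "\<dots> \<le> mean_level T"
    unfolding mean_level_def
  proof (rule integral_mono)
    show "integrable \<nu> (\<lambda>x. \<Sum>j<J. indicator {x. 2 powr (- T) \<le> mass j x} x :: real)"
      by (intro Bochner_Integration.integrable_sum integrable_real_indicator) (auto simp: emeasure_eq_measure)
    show "integrable \<nu> (\<lambda>x. real (heavy_levels T x))"
      by (rule integrable_heavy_levels[OF assms])
    fix x
    obtain J' where J': "T / a < real J'" using reals_Archimedean2 by blast
    \<comment> \<open>The range is enlarged beyond \<open>T / a\<close> so that
      \<open>heavy_levels_eq_sum\<close> applies whatever \<open>J\<close> is.\<close>
    have "(\<Sum>j<J. indicator {x. 2 powr (- T) \<le> mass j x} x :: real) \<le>
        (\<Sum>j<max J J'. indicator {x. 2 powr (- T) \<le> mass j x} x)"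
      by (intro sum_mono2) auto
    also have "\<dots> = real (heavy_levels T x)"
      using J' by (subst heavy_levels_eq_sum) auto
    finally show "(\<Sum>j<J. indicator {x. 2 powr (- T) \<le> mass j x} x) \<le> real (heavy_levels T x)" .
  qed
  finally show ?thesis .
qed

text \<open>The three terms account for the heavy cells, the light cells at levels below
  \<open>J\<close>, and the geometric Frostman tail from level \<open>J\<close> on. The cut
  \<open>J\<close> is fixed in terms of \<open>N\<close> later.\<close>

definition error_bound :: "nat \<Rightarrow> real \<Rightarrow> nat \<Rightarrow> real" where
  "error_bound N T J = mean_level T + 3 * real N * real J * 2 powr (- T)
     + 3 * real N * 2 powr (- a * real J) / (1 - 2 powr (- a))"

text \<open>Integrates the layer cake bound and exchanges sum and integral; the factor
  \<open>ln 2\<close> converts dyadic scales to natural logarithms.\<close>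

lemma nn_integral_neg_ext_ln_le:
  assumes A: "finite A" "A \<noteq> {}" "card A \<le> N" and T: "0 \<le> T"
  shows "(\<integral>\<^sup>+x. e2ennreal (- ext_ln (infdist x A)) \<partial>\<nu>) \<le> ennreal (ln 2 * error_bound N T J)"
proof -
  let ?D = "\<lambda>j. {x. infdist x A \<le> 2 powr (- real j)}"
  let ?r = "2 powr (- a)"
  have r: "0 < ?r" "?r < 1" using a_pos by (simp_all add: powr_less_one)
  have rn: "2 powr (- a * real j) = ?r ^ j" for j
    by (simp add: powr_realpow[symmetric] powr_powr)
  have g: "summable (\<lambda>j. 3 * real N * ?r ^ j)"
    using r by (intro summable_mult summable_geometric) simp
  have s: "summable (\<lambda>j. measure \<nu> (?D j))"
  proof (rule summable_comparison_test'[OF g])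
    show "norm (measure \<nu> (?D j)) \<le> 3 * real N * ?r ^ j" for j
      using measure_near_le_frostman[OF A, of j] unfolding rn by simp
  qed
  have "(\<integral>\<^sup>+x. e2ennreal (- ext_ln (infdist x A)) \<partial>\<nu>)
      \<le> (\<integral>\<^sup>+x. ennreal (ln 2) * (\<Sum>j. indicator (?D j) x) \<partial>\<nu>)"
    by (intro nn_integral_mono order.trans[OF neg_ext_ln_le_suminf]) (simp add: indicator_def)
  also have "\<dots> = ennreal (ln 2) * (\<Sum>j. emeasure \<nu> (?D j))"
    by (simp add: nn_integral_cmult nn_integral_suminf)
  also have "(\<Sum>j. emeasure \<nu> (?D j)) = ennreal (\<Sum>j. measure \<nu> (?D j))"
    by (simp add: emeasure_eq_measure suminf_ennreal2 s)
  also have "ennreal (ln 2) * \<dots> = ennreal (ln 2 * (\<Sum>j. measure \<nu> (?D j)))"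
    by (simp add: ennreal_mult suminf_nonneg s)
  also have "\<dots> \<le> ennreal (ln 2 * error_bound N T J)"
  proof (intro ennreal_leI mult_left_mono)
    \<comment> \<open>Heavy and light cells control the levels below \<open>J\<close>, the Frostman
      bound controls the rest.\<close>
    have "(\<Sum>j. measure \<nu> (?D j)) = (\<Sum>j. measure \<nu> (?D (j + J))) + (\<Sum>j<J. measure \<nu> (?D j))"
      by (rule suminf_split_initial_segment[OF s])
    also have "(\<Sum>j<J. measure \<nu> (?D j)) \<le> (\<Sum>j<J. measure \<nu> {x. 2 powr (- T) \<le> mass j x} + 3 * real N * 2 powr (- T))"
      by (intro sum_mono measure_near_le_heavy A)
    also have "\<dots> \<le> mean_level T + 3 * real N * real J * 2 powr (- T)"
      using sum_measure_heavy_le[OF T, of J] by (simp add: sum.distrib)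
    also have "(\<Sum>j. measure \<nu> (?D (j + J))) \<le> (\<Sum>j. 3 * real N * ?r ^ J * ?r ^ j)"
    proof (rule suminf_le)
      show "measure \<nu> (?D (j + J)) \<le> 3 * real N * ?r ^ J * ?r ^ j" for j
        using measure_near_le_frostman[OF A, of "j + J"] by (simp only: rn) (simp add: power_add mult_ac)
      show "summable (\<lambda>j. measure \<nu> (?D (j + J)))" using s by (subst summable_iff_shift)
      show "summable (\<lambda>j. 3 * real N * ?r ^ J * ?r ^ j)"
        using r by (intro summable_mult summable_geometric) simp
    qed
    also have "\<dots> = 3 * real N * ?r ^ J / (1 - ?r)"
      using r by (subst suminf_mult) (auto simp: suminf_geometric summable_geometric)
    finally show "(\<Sum>j. measure \<nu> (?D j)) \<le> error_bound N T J"
      unfolding error_bound_def rn by simp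
  qed simp
  finally show ?thesis .
qed


lemma mean_level_nonneg: "0 \<le> mean_level T"
  unfolding mean_level_def by simp

lemma frostman_ratio: "0 < 2 powr (- a)" "2 powr (- a) < 1"
  using a_pos by (simp_all add: powr_less_one)

lemma error_bound_nonneg: "0 \<le> error_bound N T J"
  unfolding error_bound_def using mean_level_nonneg frostman_ratio
  by (intro add_nonneg_nonneg divide_nonneg_nonneg mult_nonneg_nonneg) auto

text \<open>Dropping the positive part of the integral only lowers it, and the negative part is
  finite, so the subtraction in the extended reals is harmless.\<close>

lemma ext_exp_ge:
  assumes "finite A" "A \<noteq> {}" "card A \<le> N" "0 \<le> T"
  shows "ereal (2 powr (- error_bound N T J)) \<le> ext_exp (ext_integral \<nu> (\<lambda>x. ext_ln (infdist x A)))"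
proof -
  let ?c = "ln 2 * error_bound N T J"
  let ?Q = "\<integral>\<^sup>+x. e2ennreal (- ext_ln (infdist x A)) \<partial>\<nu>"
  let ?P = "\<integral>\<^sup>+x. e2ennreal (ext_ln (infdist x A)) \<partial>\<nu>"
  have "0 \<le> ?c" using error_bound_nonneg by simp
  have "enn2ereal ?Q \<le> enn2ereal (ennreal ?c)"
    using nn_integral_neg_ext_ln_le[OF assms] by (simp only: less_eq_ennreal.rep_eq)
  then have "enn2ereal ?Q \<le> ereal ?c" using \<open>0 \<le> ?c\<close> by simp
  then have "0 - ereal ?c \<le> enn2ereal ?P - enn2ereal ?Q"
    by (intro ereal_minus_mono) simp_all
  then have "ext_exp (ereal (- ?c)) \<le> ext_exp (ext_integral \<nu> (\<lambda>x. ext_ln (infdist x A)))"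
    unfolding ext_integral_def by (intro ext_exp_mono) simp
  then show ?thesis by (simp add: ext_exp_def powr_def mult.commute)
qed

section \<open>Upper bound from the endpoints of heavy cells\<close>

lemma mass_0:
  assumes "x \<in> {0..<1}"
  shows "mass 0 x = 1"
proof -
  have "\<lfloor>x\<rfloor> = 0" using assms by (simp add: floor_eq_iff)
  moreover have "AE y in \<nu>. y \<in> dcell 0 0"
    using AE_unit by eventually_elim (simp add: dcell_def floor_eq_iff)
  ultimately show ?thesis unfolding mass_def by (subst prob_eq_1) auto
qed

definition heavy_cells :: "real \<Rightarrow> nat \<Rightarrow> int set" where
  "heavy_cells T j = {k\<in>{0..<2 ^ j}. 2 powr (- T) \<le> measure \<nu> (dcell j k)}"

lemma finite_heavy_cells: "finite (heavy_cells T j)"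
  unfolding heavy_cells_def by (rule finite_subset[of _ "{0..<2 ^ j}"]) auto

text \<open>Cells of one level are disjoint and have total mass at most \<open>1\<close>, while each
  heavy one has mass at least \<open>2 powr (- T)\<close>.\<close>

lemma card_heavy_cells: "real (card (heavy_cells T j)) \<le> 2 powr T"
proof -
  have "real (card (heavy_cells T j)) * 2 powr (- T) = (\<Sum>k\<in>heavy_cells T j. 2 powr (- T))"
    by simp
  also have "\<dots> \<le> (\<Sum>k\<in>heavy_cells T j. measure \<nu> (dcell j k))"
    by (intro sum_mono) (simp add: heavy_cells_def)
  also have "\<dots> = measure \<nu> (\<Union>k\<in>heavy_cells T j. dcell j k)"
    by (intro finite_measure_finite_Union[symmetric] finite_heavy_cells)
       (auto simp: disjoint_family_on_def dcell_def)
  also have "\<dots> \<le> 1" by (rule prob_le_1)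
  finally show ?thesis by (simp add: powr_minus field_simps)
qed

text \<open>A nearly optimal quantizer, made of left endpoints. By the Frostman bound no cell of a
  level beyond \<open>T / a\<close> is heavy, so the finite union misses none.\<close>

definition heavy_points :: "real \<Rightarrow> real set" where
  "heavy_points T = (\<Union>j\<le>nat \<lfloor>T / a\<rfloor>. (\<lambda>k. real_of_int k / 2 ^ j) ` heavy_cells T j)"

lemma finite_heavy_points: "finite (heavy_points T)"
  unfolding heavy_points_def using finite_heavy_cells by simp

lemma card_heavy_points:
  assumes "0 \<le> T"
  shows "real (card (heavy_points T)) \<le> (T / a + 1) * 2 powr T"
proof -
  have "card (heavy_points T) \<le> (\<Sum>j\<le>nat \<lfloor>T / a\<rfloor>. card ((\<lambda>k. real_of_int k / 2 ^ j) ` heavy_cells T j))"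
    unfolding heavy_points_def by (rule card_UN_le) simp
  also have "\<dots> \<le> (\<Sum>j\<le>nat \<lfloor>T / a\<rfloor>. card (heavy_cells T j))"
    by (intro sum_mono card_image_le finite_heavy_cells)
  finally have "real (card (heavy_points T)) \<le> (\<Sum>j\<le>nat \<lfloor>T / a\<rfloor>. real (card (heavy_cells T j)))"
    by (simp only: of_nat_sum[symmetric] of_nat_le_iff)
  also have "\<dots> \<le> (\<Sum>j\<le>nat \<lfloor>T / a\<rfloor>. 2 powr T)"
    by (intro sum_mono card_heavy_cells)
  also have "\<dots> = (real_of_int \<lfloor>T / a\<rfloor> + 1) * 2 powr T"
    using assms a_pos by simp
  also have "\<dots> \<le> (T / a + 1) * 2 powr T"
    by (intro mult_right_mono) auto
  finally show ?thesis .
qed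

text \<open>If \<open>j\<close> is the deepest heavy level of \<open>x\<close>, the left endpoint of
  its cell at that level is a heavy point at distance at most \<open>2 powr (- j)\<close>.\<close>

lemma infdist_heavy_points_le:
  assumes x: "x \<in> {0..<1}" and T: "0 \<le> T"
  shows "1 \<le> heavy_levels T x" "heavy_points T \<noteq> {}"
    "infdist x (heavy_points T) \<le> 2 powr (- (real (heavy_levels T x) - 1))"
proof -
  let ?S = "{j. 2 powr (- T) \<le> mass j x}"
  have "?S \<subseteq> {..nat \<lfloor>T / a\<rfloor>}"
    using heavy_level_le by (auto simp: le_nat_floor)
  then have fin: "finite ?S" by (rule finite_subset) simp
  \<comment> \<open>Level \<open>0\<close> is always heavy, because a single cell carries the whole
    mass; so the maximum below exists.\<close>
  have "0 \<in> ?S" using mass_0[OF x] T powr_mono[of "- T" 0 2] by simp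
  then have ne: "?S \<noteq> {}" by blast
  then show "1 \<le> heavy_levels T x"
    unfolding heavy_levels_def using fin by (simp add: Suc_le_eq card_gt_0_iff)
  define j where "j = Max ?S"
  have j: "2 powr (- T) \<le> mass j x" using Max_in[OF fin ne] by (simp add: j_def)
  have "\<lfloor>2 ^ j * x\<rfloor> \<in> heavy_cells T j"
    using j x by (auto simp: heavy_cells_def mass_def floor_less_iff)
  moreover have "j \<le> nat \<lfloor>T / a\<rfloor>" using heavy_level_le[OF j] by (simp add: le_nat_floor)
  ultimately have y: "real_of_int \<lfloor>2 ^ j * x\<rfloor> / 2 ^ j \<in> heavy_points T"
    unfolding heavy_points_def by blast
  then show "heavy_points T \<noteq> {}" by blast
  have "\<bar>x - real_of_int \<lfloor>2 ^ j * x\<rfloor> / 2 ^ j\<bar> = \<bar>2 ^ j * x - real_of_int \<lfloor>2 ^ j * x\<rfloor>\<bar> / 2 ^ j"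
    by (simp add: field_simps flip: abs_div_pos)
  also have "\<dots> \<le> 1 / 2 ^ j" by (intro divide_right_mono) (linarith, simp)
  also have "\<dots> = 2 powr (- real j)" by (simp add: powr_minus powr_realpow divide_inverse)
  finally have "infdist x (heavy_points T) \<le> 2 powr (- real j)"
    using y by (subst infdist_finite_le_iff) (auto simp: finite_heavy_points)
  \<comment> \<open>Levels are numbered from \<open>0\<close>, so at most \<open>j + 1\<close> of
    them are heavy; this is the source of the \<open>- 1\<close> in the exponent.\<close>
  also have "card ?S \<le> card {..j}"
    using fin by (intro card_mono) (auto simp: j_def)
  then have "2 powr (- real j) \<le> 2 powr (- (real (heavy_levels T x) - 1))"
    unfolding heavy_levels_def by simp
  finally show "infdist x (heavy_points T) \<le> 2 powr (- (real (heavy_levels T x) - 1))" .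
qed

text \<open>Almost all distances are at most \<open>1\<close>, so only the negative part of the
  integral remains, and it dominates \<open>ln 2\<close> times the mean number of heavy levels minus
  one.\<close>

lemma ext_exp_heavy_points_le:
  assumes T: "0 \<le> T"
  shows "ext_exp (ext_integral \<nu> (\<lambda>x. ext_ln (infdist x (heavy_points T)))) \<le> ereal (2 powr (- (mean_level T - 1)))"
proof -
  let ?d = "\<lambda>x. infdist x (heavy_points T)"
  let ?h = "\<lambda>x. ln 2 * (real (heavy_levels T x) - 1)"
  have int: "integrable \<nu> ?h" using integrable_heavy_levels[OF T] by simp
  have intv: "(\<integral>x. ?h x \<partial>\<nu>) = ln 2 * (mean_level T - 1)"
    using integrable_heavy_levels[OF T] by (simp add: mean_level_def prob_space[simplified])
  have nn: "AE x in \<nu>. 0 \<le> ?h x"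
    using AE_unit by eventually_elim (use infdist_heavy_points_le(1)[OF _ T] in auto)
  have c: "0 \<le> ln 2 * (mean_level T - 1)"
    using integral_nonneg_AE[OF nn] intv by simp
  have "AE x in \<nu>. e2ennreal (ext_ln (?d x)) = 0"
    using AE_unit
  proof eventually_elim
    case (elim x)
    have "?d x \<le> 2 powr (- (real (heavy_levels T x) - 1))" by (rule infdist_heavy_points_le(3)[OF elim T])
    also have "\<dots> \<le> 2 powr 0" using infdist_heavy_points_le(1)[OF elim T] by (intro powr_mono) auto
    finally show ?case by (simp add: ext_ln_def ennreal_neg e2ennreal_neg)
  qed
  then have P: "(\<integral>\<^sup>+x. e2ennreal (ext_ln (?d x)) \<partial>\<nu>) = 0"
    by (subst nn_integral_cong_AE[where v = "\<lambda>_. 0"]) auto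
  have "ennreal (ln 2 * (mean_level T - 1)) = (\<integral>\<^sup>+x. ennreal (?h x) \<partial>\<nu>)"
    using nn_integral_eq_integral[OF int nn] intv by simp
  also have "\<dots> \<le> (\<integral>\<^sup>+x. e2ennreal (- ext_ln (?d x)) \<partial>\<nu>)"
  proof (rule nn_integral_mono_AE)
    show "AE x in \<nu>. ennreal (?h x) \<le> e2ennreal (- ext_ln (?d x))"
      using AE_unit
    proof eventually_elim
      case (elim x)
      show ?case
      proof (cases "?d x \<le> 0")
        case True
        \<comment> \<open>At distance \<open>0\<close> the right-hand side is infinite.\<close>
        then show ?thesis by (simp add: ext_ln_def)
      next
        case False
        then have "ln (?d x) \<le> ln (2 powr (- (real (heavy_levels T x) - 1)))"
          using infdist_heavy_points_le(3)[OF elim T] by (subst ln_le_cancel_iff) auto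
        then have "?h x \<le> - ln (?d x)" by (simp add: ln_powr algebra_simps)
        then show ?thesis using False by (simp add: ext_ln_def ennreal_leI)
      qed
    qed
  qed
  finally have "ereal (ln 2 * (mean_level T - 1)) \<le> enn2ereal (\<integral>\<^sup>+x. e2ennreal (- ext_ln (?d x)) \<partial>\<nu>)"
    unfolding less_eq_ennreal.rep_eq using c by simp
  then have "0 - enn2ereal (\<integral>\<^sup>+x. e2ennreal (- ext_ln (?d x)) \<partial>\<nu>) \<le> 0 - ereal (ln 2 * (mean_level T - 1))"
    by (intro ereal_minus_mono) simp_all
  then have "ext_integral \<nu> (\<lambda>x. ext_ln (?d x)) \<le> ereal (- (ln 2 * (mean_level T - 1)))"
    unfolding ext_integral_def P by (simp add: zero_ennreal.rep_eq)
  then have "ext_exp (ext_integral \<nu> (\<lambda>x. ext_ln (?d x))) \<le> ext_exp (ereal (- (ln 2 * (mean_level T - 1))))"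
    by (rule ext_exp_mono)
  also have "\<dots> = ereal (2 powr (- (mean_level T - 1)))"
    by (simp add: ext_exp_def powr_def algebra_simps)
  finally show ?thesis .
qed

section \<open>Optimal error and its asymptotics\<close>

definition quant_inf :: "nat \<Rightarrow> ereal" where
  "quant_inf N = (INF A\<in>{A :: real set. finite A \<and> 1 \<le> card A \<and> card A \<le> N}.
        ext_exp (ext_integral \<nu> (\<lambda>x. ext_ln (infdist x A))))"

lemma quant_inf_ge:
  assumes "0 \<le> T"
  shows "ereal (2 powr (- error_bound N T J)) \<le> quant_inf N"
  unfolding quant_inf_def
proof (rule INF_greatest)
  fix A :: "real set" assume "A \<in> {A. finite A \<and> 1 \<le> card A \<and> card A \<le> N}"
  then have "finite A" "A \<noteq> {}" "card A \<le> N" by auto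
  then show "ereal (2 powr (- error_bound N T J)) \<le> ext_exp (ext_integral \<nu> (\<lambda>x. ext_ln (infdist x A)))"
    by (rule ext_exp_ge) (rule assms)
qed

lemma quant_inf_le:
  assumes "0 \<le> T" "(T / a + 1) * 2 powr T \<le> real N"
  shows "quant_inf N \<le> ereal (2 powr (- (mean_level T - 1)))"
proof -
  have "real (card (heavy_points T)) \<le> real N"
    using card_heavy_points[OF assms(1)] assms(2) by linarith
  moreover have "heavy_points T \<noteq> {}"
    using infdist_heavy_points_le(2)[of 0 T] assms(1) by simp
  ultimately have "heavy_points T \<in> {A :: real set. finite A \<and> 1 \<le> card A \<and> card A \<le> N}"
    using finite_heavy_points[of T] by (simp add: Suc_le_eq card_gt_0_iff)
  then have "quant_inf N \<le> ext_exp (ext_integral \<nu> (\<lambda>x. ext_ln (infdist x (heavy_points T))))"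
    unfolding quant_inf_def by (rule INF_lower)
  also note ext_exp_heavy_points_le[OF assms(1)]
  finally show ?thesis .
qed

text \<open>The infimum lies between two reals, so \<open>real_of_ereal\<close> in
  \<open>quant_error0\<close> does not hit its default value. For \<open>T = 0\<close> the size
  condition of the upper bound becomes \<open>1 \<le> N\<close>.\<close>

lemma quant_inf_eq:
  assumes "1 \<le> N"
  shows "quant_inf N = ereal (quant_error0 \<nu> N)"
proof -
  have "quant_inf N \<le> ereal (2 powr (- (mean_level 0 - 1)))"
    using assms by (intro quant_inf_le) auto
  moreover have "ereal (2 powr (- error_bound N 0 0)) \<le> quant_inf N"
    by (rule quant_inf_ge) simp
  ultimately have "\<bar>quant_inf N\<bar> \<noteq> \<infinity>" by (cases "quant_inf N") auto
  then show ?thesis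
    unfolding quant_error0_def quant_inf_def[symmetric] by (simp add: ereal_real)
qed

lemma log_quant_error_le:
  assumes "1 \<le> N" "0 \<le> T"
  shows "- log 2 (quant_error0 \<nu> N) \<le> error_bound N T J"
proof -
  have *: "2 powr (- error_bound N T J) \<le> quant_error0 \<nu> N"
    using quant_inf_ge[OF assms(2), of N J] quant_inf_eq[OF assms(1)] by simp
  then have "0 < quant_error0 \<nu> N" by (rule less_le_trans[rotated]) simp
  then have "- error_bound N T J \<le> log 2 (quant_error0 \<nu> N)"
    using * by (subst le_log_iff) auto
  then show ?thesis by simp
qed

lemma log_quant_error_ge:
  assumes "1 \<le> N" "0 \<le> T" "(T / a + 1) * 2 powr T \<le> real N"
  shows "mean_level T - 1 \<le> - log 2 (quant_error0 \<nu> N)"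
proof -
  \<comment> \<open>The logarithm is monotone only on positive arguments; the crude choice
    \<open>T = J = 0\<close> already shows that the error is positive.\<close>
  have "2 powr (- error_bound N 0 0) \<le> quant_error0 \<nu> N"
    using quant_inf_ge[of 0 N 0] quant_inf_eq[OF assms(1)] by simp
  then have pos: "0 < quant_error0 \<nu> N" by (rule less_le_trans[rotated]) simp
  have "quant_error0 \<nu> N \<le> 2 powr (- (mean_level T - 1))"
    using quant_inf_le[OF assms(2,3)] quant_inf_eq[OF assms(1)] by simp
  then have "log 2 (quant_error0 \<nu> N) \<le> - (mean_level T - 1)"
    using pos by (subst log_le_iff) auto
  then show ?thesis by simp
qed

text \<open>Replacing \<open>L\<close> by a threshold of the same leading order does not change the
  limit; this is applied to \<open>L - sqrt L\<close> and \<open>L + sqrt L\<close>.\<close>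

lemma mean_level_shifted_tendsto:
  assumes "filterlim g at_top at_top" "((\<lambda>L. g L / L) \<longlongrightarrow> 1) at_top"
  shows "((\<lambda>L. mean_level (g L) / L) \<longlongrightarrow> (\<integral>x. 1 / s x \<partial>\<nu>)) at_top"
proof -
  have "((\<lambda>L. (mean_level (g L) / g L) * (g L / L)) \<longlongrightarrow> (\<integral>x. 1 / s x \<partial>\<nu>) * 1) at_top"
    by (intro tendsto_mult filterlim_compose[OF mean_level_tendsto] assms)
  moreover have "\<forall>\<^sub>F L in at_top. (mean_level (g L) / g L) * (g L / L) = mean_level (g L) / L"
    using filterlim_at_top_dense[THEN iffD1, OF assms(1), rule_format, of 0] by eventually_elim simp
  ultimately have "((\<lambda>L. mean_level (g L) / L) \<longlongrightarrow> (\<integral>x. 1 / s x \<partial>\<nu>) * 1) at_top"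
    by (rule Lim_transform_eventually)
  then show ?thesis by simp
qed

text \<open>With \<open>T = L + sqrt L\<close> the light cells contribute a multiple of
  \<open>J * 2 powr (- sqrt L)\<close>, which tends to \<open>0\<close> although \<open>J\<close> is
  of order \<open>L\<close>. As \<open>J \<ge> L / a\<close>, the factor
  \<open>N * 2 powr (- a * J)\<close> is at most \<open>1\<close> and the tail stays
  bounded.\<close>

lemma error_bound_le:
  assumes "1 \<le> N" and L: "L = log 2 (real N)"
  shows "error_bound N (L + sqrt L) (nat \<lceil>L / a\<rceil>) \<le>
    mean_level (L + sqrt L) + 3 * (L / a + 1) * 2 powr (- sqrt L) + 3 / (1 - 2 powr (- a))"
proof -
  let ?J = "nat \<lceil>L / a\<rceil>"
  have N: "real N = 2 powr L" using assms by simp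
  have "0 \<le> L" using assms by simp
  then have J: "real ?J \<le> L / a + 1" "L / a \<le> real ?J"
    using a_pos by (simp_all add: of_nat_nat ceiling_correct)
  have r: "2 powr (- a) < 1" by (rule frostman_ratio)
  have "3 * real N * real ?J * 2 powr (- (L + sqrt L)) = 3 * real ?J * 2 powr (- sqrt L)"
    unfolding N by (simp add: powr_add[symmetric] mult_ac)
  also have "\<dots> \<le> 3 * (L / a + 1) * 2 powr (- sqrt L)"
    using J(1) by (intro mult_right_mono mult_left_mono) auto
  finally have 1: "3 * real N * real ?J * 2 powr (- (L + sqrt L)) \<le> 3 * (L / a + 1) * 2 powr (- sqrt L)" .
  have "L \<le> a * real ?J" using J(2) a_pos by (simp add: field_simps)
  then have "2 powr L * 2 powr (- a * real ?J) \<le> 1"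
    using powr_mono[of "L - a * real ?J" 0 2] by (simp add: powr_add[symmetric])
  then have "3 * real N * 2 powr (- a * real ?J) / (1 - 2 powr (- a)) \<le> 3 / (1 - 2 powr (- a))"
    unfolding N using r by (intro divide_right_mono) auto
  with 1 show ?thesis unfolding error_bound_def by linarith
qed

text \<open>The reciprocal of the ratio is squeezed between the mean levels at
  \<open>L - sqrt L\<close> and \<open>L + sqrt L\<close>, divided by \<open>L\<close> and up to
  lower order terms; its limit is positive and can be inverted.\<close>

theorem quant_ratio0_tendsto: "quant_ratio0 \<nu> \<longlonglongrightarrow> inverse (\<integral>x. 1 / s x \<partial>\<nu>)"
proof -
  let ?I = "\<integral>x. 1 / s x \<partial>\<nu>"
  let ?L = "\<lambda>N. log 2 (real N)"
  have L: "filterlim ?L at_top sequentially" by real_asymp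
  \<comment> \<open>Lowering the threshold by \<open>sqrt L\<close> absorbs the factor
    \<open>T / a + 1\<close> in the number of heavy points, which is then at most \<open>N\<close>
    for large \<open>N\<close>.\<close>
  have lower: "((\<lambda>L. (mean_level (L - sqrt L) - 1) / L) \<longlongrightarrow> ?I) at_top"
  proof -
    have "((\<lambda>L. mean_level (L - sqrt L) / L - 1 / L) \<longlongrightarrow> ?I - 0) at_top"
      by (intro tendsto_diff mean_level_shifted_tendsto) real_asymp+
    then show ?thesis by (simp add: diff_divide_distrib)
  qed
  have upper: "((\<lambda>L. (mean_level (L + sqrt L) + 3 * (L / a + 1) * 2 powr (- sqrt L) + 3 / (1 - 2 powr (- a))) / L)
      \<longlongrightarrow> ?I) at_top"
  proof -
    have "((\<lambda>L. 3 * (L / a + 1) * 2 powr (- sqrt L) / L) \<longlongrightarrow> 0) at_top"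
      using a_pos by real_asymp
    moreover have "((\<lambda>L::real. 3 / (1 - 2 powr (- a)) / L) \<longlongrightarrow> 0) at_top"
      by (intro tendsto_divide_0[OF tendsto_const] filterlim_at_top_imp_at_infinity filterlim_ident)
    ultimately have "((\<lambda>L. mean_level (L + sqrt L) / L + 3 * (L / a + 1) * 2 powr (- sqrt L) / L
        + 3 / (1 - 2 powr (- a)) / L) \<longlongrightarrow> ?I + 0 + 0) at_top"
      by (intro tendsto_add mean_level_shifted_tendsto) real_asymp+
    then show ?thesis by (simp add: add_divide_distrib)
  qed
  have "(\<lambda>N. - log 2 (quant_error0 \<nu> N) / ?L N) \<longlonglongrightarrow> ?I"
  proof (rule tendsto_sandwich[OF _ _ filterlim_compose[OF lower L] filterlim_compose[OF upper L]])
    have "\<forall>\<^sub>F L in at_top. 0 \<le> L - sqrt L \<and> ((L - sqrt L) / a + 1) * 2 powr (L - sqrt L) \<le> 2 powr L"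
    proof (rule eventually_conj)
      show "\<forall>\<^sub>F L in at_top. 0 \<le> L - sqrt L" by real_asymp
      show "\<forall>\<^sub>F L in at_top. ((L - sqrt L) / a + 1) * 2 powr (L - sqrt L) \<le> 2 powr L"
        using a_pos by real_asymp
    qed
    then have "\<forall>\<^sub>F N in sequentially. 0 \<le> ?L N - sqrt (?L N) \<and>
        ((?L N - sqrt (?L N)) / a + 1) * 2 powr (?L N - sqrt (?L N)) \<le> 2 powr ?L N"
      by (rule eventually_compose_filterlim[OF _ L])
    then show "\<forall>\<^sub>F N in sequentially. (mean_level (?L N - sqrt (?L N)) - 1) / ?L N \<le> - log 2 (quant_error0 \<nu> N) / ?L N"
      using eventually_ge_at_top[of 1]
    proof eventually_elim
      case (elim N)
      then show ?case by (intro divide_right_mono log_quant_error_ge) auto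
    qed
    show "\<forall>\<^sub>F N in sequentially. - log 2 (quant_error0 \<nu> N) / ?L N \<le>
      (mean_level (?L N + sqrt (?L N)) + 3 * (?L N / a + 1) * 2 powr (- sqrt (?L N)) + 3 / (1 - 2 powr (- a))) / ?L N"
      using eventually_ge_at_top[of 1]
    proof eventually_elim
      case (elim N)
      then have "0 \<le> ?L N" by simp
      then show ?case
        using elim by (intro divide_right_mono order.trans[OF log_quant_error_le error_bound_le]) auto
    qed
  qed
  then have "(\<lambda>N. inverse (- log 2 (quant_error0 \<nu> N) / ?L N)) \<longlonglongrightarrow> inverse ?I"
    using integral_inverse_s_pos by (intro tendsto_inverse) auto
  then show ?thesis by (simp add: quant_ratio0_def[abs_def] inverse_eq_divide)
qed

end

section \<open>Binary entropy\<close>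

lemma h2_measurable [measurable]: "h2 \<in> borel_measurable borel"
  unfolding h2_def[abs_def] by measurable

lemma h2_pos:
  assumes "0 < p" "p < 1"
  shows "0 < h2 p"
proof -
  have "log 2 p < 0" "log 2 (1 - p) < 0" using assms by simp_all
  then have "p * log 2 p < 0" "(1 - p) * log 2 (1 - p) < 0"
    using assms by (simp_all add: mult_less_0_iff)
  then show ?thesis by (simp add: h2_def)
qed

text \<open>Minus the logarithm, per digit, of the weight that the parameter \<open>q\<close> gives
  to a word with frequency \<open>t\<close> of ones.\<close>

definition cross_entropy :: "real \<Rightarrow> real \<Rightarrow> real" where
  "cross_entropy t q = - t * log 2 q - (1 - t) * log 2 (1 - q)"

lemma cross_entropy_self: "cross_entropy p p = h2 p"
  by (simp add: cross_entropy_def h2_def)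

text \<open>Gibbs' inequality. It follows from \<open>ln u \<le> u - 1\<close> at
  \<open>u = q / t\<close> and at \<open>u = (1 - q) / (1 - t)\<close>, because the right-hand sides
  cancel when weighted by \<open>t\<close> and \<open>1 - t\<close>.\<close>

lemma h2_le_cross_entropy:
  assumes t: "0 < t" "t < 1" and q: "0 < q" "q < 1"
  shows "h2 t \<le> cross_entropy t q"
proof -
  have "t * (ln q - ln t) \<le> t * (q / t - 1)"
    using assms ln_le_minus_one[of "q / t"] by (intro mult_left_mono) (simp_all add: ln_div)
  moreover have "(1 - t) * (ln (1 - q) - ln (1 - t)) \<le> (1 - t) * ((1 - q) / (1 - t) - 1)"
    using assms ln_le_minus_one[of "(1 - q) / (1 - t)"] by (intro mult_left_mono) (simp_all add: ln_div)
  moreover have "t * (q / t - 1) + (1 - t) * ((1 - q) / (1 - t) - 1) = 0"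
    using assms by (simp add: field_simps)
  ultimately have "t * (ln q - ln t) + (1 - t) * (ln (1 - q) - ln (1 - t)) \<le> 0"
    by linarith
  then have "(t * (ln q - ln t) + (1 - t) * (ln (1 - q) - ln (1 - t))) / ln 2 \<le> 0"
    by (simp add: divide_le_0_iff)
  moreover have "h2 t - cross_entropy t q = (t * (ln q - ln t) + (1 - t) * (ln (1 - q) - ln (1 - t))) / ln 2"
    by (simp add: h2_def cross_entropy_def log_def field_simps)
  ultimately show ?thesis by simp
qed

lemma bernoulli_weight_eq_powr:
  assumes "0 < q" "q < 1" "k \<le> n" "0 < n"
  shows "q ^ k * (1 - q) ^ (n - k) = 2 powr (- real n * cross_entropy (real k / real n) q)"
proof -
  have "2 powr (- real n * cross_entropy (real k / real n) q) =
      2 powr (real k * log 2 q + (real n - real k) * log 2 (1 - q))"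
  proof -
    have *: "real n * (real k / real n) = real k" using assms(4) by simp
    have "- real n * cross_entropy t q = (real n * t) * log 2 q + (real n - real n * t) * log 2 (1 - q)" for t
      by (simp add: cross_entropy_def algebra_simps)
    from this[of "real k / real n"] show ?thesis unfolding * by simp
  qed
  also have "\<dots> = (2 powr log 2 q) powr real k * (2 powr log 2 (1 - q)) powr real (n - k)"
    using assms(3) by (simp only: powr_add powr_powr of_nat_diff mult.commute)
  also have "\<dots> = q ^ k * (1 - q) ^ (n - k)"
    using assms by (simp add: powr_realpow del: of_nat_diff)
  finally show ?thesis ..
qed

section \<open>Dyadic intervals\<close>

lemma last_dyadic_endpoint:
  assumes "Suc k = 2 ^ n"
  shows "(1 + real k) / 2 ^ n = 1"
proof -
  have "real (Suc k) = real (2 ^ n)" by (simp only: assms)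
  then show ?thesis by simp
qed

text \<open>Away from the point \<open>1\<close> the closed last interval behaves like a half-open
  one, so membership is a statement about floors.\<close>

lemma mem_dyadic_interval_iff:
  assumes "x \<in> {0..<1}" "k < 2 ^ n"
  shows "x \<in> dyadic_interval n k \<longleftrightarrow> \<lfloor>2 ^ n * x\<rfloor> = int k"
proof -
  have "\<lfloor>2 ^ n * x\<rfloor> = int k \<longleftrightarrow> real k / 2 ^ n \<le> x \<and> x < real (Suc k) / 2 ^ n"
    by (auto simp: floor_eq_iff field_simps)
  then show ?thesis using assms last_dyadic_endpoint[of k n] by (auto simp: dyadic_interval_def)
qed

lemma floor_dyadic_bounds:
  assumes "x \<in> {0..<1::real}"
  shows "0 \<le> \<lfloor>2 ^ n * x\<rfloor>" "nat \<lfloor>2 ^ n * x\<rfloor> < 2 ^ n"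
proof -
  show 0: "0 \<le> \<lfloor>2 ^ n * x\<rfloor>" using assms by simp
  have "\<lfloor>2 ^ n * x\<rfloor> < 2 ^ n" using assms by (simp add: floor_less_iff)
  then show "nat \<lfloor>2 ^ n * x\<rfloor> < 2 ^ n" using 0 by (simp add: nat_less_iff)
qed

lemma dyadic_at_eq:
  assumes "x \<in> {0..<1}"
  shows "dyadic_at n x = dyadic_interval n (nat \<lfloor>2 ^ n * x\<rfloor>)"
  unfolding dyadic_at_def
proof (rule the_equality)
  show "dyadic_interval n (nat \<lfloor>2 ^ n * x\<rfloor>) \<in> dyadic n \<and> x \<in> dyadic_interval n (nat \<lfloor>2 ^ n * x\<rfloor>)"
    using mem_dyadic_interval_iff[OF assms floor_dyadic_bounds(2)[OF assms, of n]] floor_dyadic_bounds[OF assms, of n]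
    by (auto simp: dyadic_def)
next
  fix Q assume "Q \<in> dyadic n \<and> x \<in> Q"
  then obtain k where "k < 2 ^ n" "Q = dyadic_interval n k" "x \<in> dyadic_interval n k"
    by (auto simp: dyadic_def)
  then show "Q = dyadic_interval n (nat \<lfloor>2 ^ n * x\<rfloor>)"
    using mem_dyadic_interval_iff[OF assms] by simp
qed

lemma dyadic_at_mem:
  assumes "x \<in> {0..<1}"
  shows "dyadic_at n x \<in> dyadic n" "x \<in> dyadic_at n x"
  using mem_dyadic_interval_iff[OF assms floor_dyadic_bounds(2)[OF assms, of n]] floor_dyadic_bounds[OF assms, of n]
  by (auto simp: dyadic_at_eq[OF assms] dyadic_def)

lemma mem_dyadic_iff:
  assumes "x \<in> {0..<1}" "Q \<in> dyadic n"
  shows "x \<in> Q \<longleftrightarrow> Q = dyadic_at n x"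
  using assms mem_dyadic_interval_iff[OF assms(1)] dyadic_at_mem[OF assms(1)]
  by (auto simp: dyadic_def dyadic_at_eq)

lemma dyadic_subset_unit: "Q \<in> dyadic n \<Longrightarrow> Q \<subseteq> {0..1}"
proof -
  assume "Q \<in> dyadic n"
  then obtain k where k: "k < 2 ^ n" "Q = dyadic_interval n k" by (auto simp: dyadic_def)
  then have "real (Suc k) \<le> real (2 ^ n)" by (subst of_nat_le_iff) simp
  then have "real (Suc k) / 2 ^ n \<le> 1" by (simp add: field_simps)
  moreover have "0 \<le> real k / 2 ^ n" by simp
  moreover have "real k / 2 ^ n \<le> y \<and> (y \<le> 1 \<or> y < real (Suc k) / 2 ^ n)" if "y \<in> Q" for y
    using that by (auto simp: k(2) dyadic_interval_def split: if_splits)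
  ultimately show ?thesis unfolding subset_iff atLeastAtMost_iff by (meson le_less_trans less_le_trans less_imp_le order.trans)
qed

text \<open>Outside the unit interval nothing satisfies the definite description, which therefore
  denotes one fixed unspecified set. The point \<open>2\<close> is an arbitrary representative;
  measurability relies on this.\<close>

lemma dyadic_at_outside:
  assumes "x \<notin> {0..1}"
  shows "dyadic_at n x = dyadic_at n 2"
proof -
  have "(\<lambda>Q. Q \<in> dyadic n \<and> x \<in> Q) = (\<lambda>Q. Q \<in> dyadic n \<and> 2 \<in> Q)"
    using dyadic_subset_unit[of _ n] assms by fastforce
  then show ?thesis by (simp add: dyadic_at_def)
qed

lemma finite_dyadic: "finite (dyadic n)"
  unfolding dyadic_def by simp

lemma dyadic_measurable: "Q \<in> dyadic n \<Longrightarrow> Q \<in> sets borel"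
  by (auto simp: dyadic_def dyadic_interval_def)

text \<open>Its left endpoint represents an interval; this carries bounds for the interval of a
  point over to all of \<open>dyadic n\<close>.\<close>

lemma dyadic_eq_dyadic_at:
  assumes "Q \<in> dyadic n"
  obtains x where "x \<in> {0..<1}" "Q = dyadic_at n x"
proof -
  obtain k where k: "k < 2 ^ n" "Q = dyadic_interval n k" using assms by (auto simp: dyadic_def)
  have "real k / 2 ^ n < 1" using k(1) by (simp add: of_nat_less_numeral_power_cancel_iff)
  then have x: "real k / 2 ^ n \<in> {0..<1}" by simp
  have "dyadic_at n (real k / 2 ^ n) = Q"
    unfolding dyadic_at_eq[OF x] k(2) by simp
  then show ?thesis using x that by blast
qed

lemma dyadic_at_ball:
  assumes "x \<in> {0..<1}" "1 / 2 ^ n < e"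
  shows "dyadic_at n x \<subseteq> ball x e"
proof
  fix y assume y: "y \<in> dyadic_at n x"
  obtain k where k: "k < 2 ^ n" "dyadic_at n x = dyadic_interval n k"
    using dyadic_at_mem(1)[OF assms(1)] by (auto simp: dyadic_def)
  have "z \<in> {real k / 2 ^ n .. real (Suc k) / 2 ^ n}" if "z \<in> dyadic_at n x" for z
    using that last_dyadic_endpoint[of k n] unfolding k(2) dyadic_interval_def by (auto split: if_splits)
  from this[OF y] this[OF dyadic_at_mem(2)[OF assms(1)]]
  have "\<bar>x - y\<bar> \<le> 1 / 2 ^ n"
    by (simp add: add_divide_distrib abs_le_iff)
  then show "y \<in> ball x e" using assms(2) by (simp add: dist_real_def)
qed

section \<open>Mixtures\<close>

locale bernoulli_mix = \<rho>: prob_space \<rho> for \<rho> :: "real measure" +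
  fixes p_minus p_plus :: real
  assumes p_bounds: "0 < p_minus" "p_minus < p_plus" "p_plus \<le> 1 / 2"
    and sets_rho [measurable_cong, simp]: "sets \<rho> = sets borel"
    and rho_range: "emeasure \<rho> {p_minus..p_plus} = 1"
begin

abbreviation \<nu> :: "real measure" where "\<nu> \<equiv> bernoulli_mixture \<rho>"

lemma space_rho [simp]: "space \<rho> = UNIV"
  using sets_eq_imp_space_eq[OF sets_rho] by simp

lemma AE_range: "AE p in \<rho>. p \<in> {p_minus..p_plus}"
  using rho_range by (subst \<rho>.AE_in_set_eq_1) (simp_all add: \<rho>.emeasure_eq_measure)

lemma range_unit: "p \<in> {p_minus..p_plus} \<Longrightarrow> 0 < p \<and> p < 1"
  using p_bounds by auto

lemma kernel_measurable [measurable]: "bernoulli_measure \<in> measurable \<rho> (subprob_algebra borel)"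
  using measurable_prob_algebraD[OF measurable_bernoulli_measure] by (simp cong: measurable_cong_sets)

lemma prob_space_bernoulli: "prob_space (bernoulli_measure p)"
  using measurable_space[OF measurable_bernoulli_measure, of p] by (simp add: space_prob_algebra)

lemma sets_mixture [simp, measurable_cong]: "sets \<nu> = sets borel"
  unfolding bernoulli_mixture_def by (rule sets_bind[OF sets_kernel[OF kernel_measurable]]) auto

lemma space_mixture [simp]: "space \<nu> = UNIV"
  using sets_eq_imp_space_eq[OF sets_mixture] by simp

sublocale N: prob_space \<nu>
  unfolding bernoulli_mixture_def
  by (rule \<rho>.prob_space_bind[OF _ kernel_measurable]) (simp add: prob_space_bernoulli)

lemma AE_mixture_iff:
  assumes "Measurable.pred borel P"
  shows "(AE x in \<nu>. P x) \<longleftrightarrow> (AE p in \<rho>. AE x in bernoulli_measure p. P x)"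
  unfolding bernoulli_mixture_def by (rule AE_bind[OF kernel_measurable assms])

lemma AE_mixture_unit: "AE x in \<nu>. x \<in> {0..<1}"
proof (subst AE_mixture_iff)
  show "AE p in \<rho>. AE x in bernoulli_measure p. x \<in> {0..<1}"
    using AE_range
  proof eventually_elim
    case (elim p)
    then show ?case using range_unit[OF elim] by (intro AE_bernoulli_measure_unit) auto
  qed
qed measurable

text \<open>As \<open>p_plus \<le> 1 / 2\<close>, both \<open>p\<close> and \<open>1 - p\<close> lie
  between \<open>p_minus\<close> and \<open>1 - p_minus\<close>, which bounds every factor.\<close>

lemma weight_bounds:
  assumes "p \<in> {p_minus..p_plus}" "k \<le> n"
  shows "p ^ k * (1 - p) ^ (n - k) \<le> (1 - p_minus) ^ n" "p_minus ^ n \<le> p ^ k * (1 - p) ^ (n - k)"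
proof -
  have b: "0 < p_minus" "p_minus \<le> p" "p \<le> 1 - p" "p \<le> 1 - p_minus" using assms p_bounds by auto
  have "p ^ k * (1 - p) ^ (n - k) \<le> (1 - p_minus) ^ k * (1 - p_minus) ^ (n - k)"
    using b by (intro mult_mono power_mono) auto
  then show "p ^ k * (1 - p) ^ (n - k) \<le> (1 - p_minus) ^ n"
    using assms(2) by (simp add: power_add[symmetric])
  have "p_minus ^ k * p_minus ^ (n - k) \<le> p ^ k * (1 - p) ^ (n - k)"
    using b by (intro mult_mono power_mono) auto
  then show "p_minus ^ n \<le> p ^ k * (1 - p) ^ (n - k)"
    using assms(2) by (simp add: power_add[symmetric])
qed

lemma integrable_weight:
  assumes "k \<le> n"
  shows "integrable \<rho> (\<lambda>p. p ^ k * (1 - p) ^ (n - k))"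
proof (rule \<rho>.integrable_const_bound[where B = "(1 - p_minus) ^ n"])
  show "AE p in \<rho>. norm (p ^ k * (1 - p) ^ (n - k)) \<le> (1 - p_minus) ^ n"
    using AE_range
  proof eventually_elim
    case (elim p)
    moreover have "0 \<le> p ^ k * (1 - p) ^ (n - k)" using range_unit[OF elim] by simp
    ultimately show ?case using weight_bounds(1)[OF elim assms] by simp
  qed
qed measurable

text \<open>Averages \<open>measure_bernoulli_dcell\<close> over \<open>\<rho>\<close>; the number
  of ones depends on \<open>x\<close> but not on \<open>p\<close>.\<close>

lemma measure_mixture_dcell:
  assumes "x \<in> {0..<1}"
  shows "measure \<nu> (dcell n \<lfloor>2 ^ n * x\<rfloor>) = (\<integral>p. p ^ ones n x * (1 - p) ^ (n - ones n x) \<partial>\<rho>)"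
proof -
  let ?w = "\<lambda>p :: real. p ^ ones n x * (1 - p) ^ (n - ones n x)"
  have nn: "AE p in \<rho>. 0 \<le> ?w p"
    using AE_range by eventually_elim (use range_unit in force)
  have "emeasure \<nu> (dcell n \<lfloor>2 ^ n * x\<rfloor>) = (\<integral>\<^sup>+p. emeasure (bernoulli_measure p) (dcell n \<lfloor>2 ^ n * x\<rfloor>) \<partial>\<rho>)"
    by (rule emeasure_bernoulli_mixture) (auto intro: \<rho>.prob_space_axioms)
  also have "\<dots> = (\<integral>\<^sup>+p. ennreal (?w p) \<partial>\<rho>)"
  proof (rule nn_integral_cong_AE)
    show "AE p in \<rho>. emeasure (bernoulli_measure p) (dcell n \<lfloor>2 ^ n * x\<rfloor>) = ennreal (?w p)"
      using AE_range
    proof eventually_elim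
      case (elim p)
      interpret B: prob_space "bernoulli_measure p" by (rule prob_space_bernoulli)
      show ?case using range_unit[OF elim] assms
        by (subst B.emeasure_eq_measure) (simp add: measure_bernoulli_dcell)
    qed
  qed
  also have "\<dots> = ennreal (\<integral>p. ?w p \<partial>\<rho>)"
    by (rule nn_integral_eq_integral[OF integrable_weight[OF ones_le] nn])
  finally show ?thesis
    using integral_nonneg_AE[OF nn] by (simp add: N.emeasure_eq_measure)
qed

text \<open>The two sets differ only outside \<open>{0..<1}\<close>, where \<open>\<nu>\<close> has
  no mass.\<close>

lemma measure_dyadic_at:
  assumes "x \<in> {0..<1}"
  shows "measure \<nu> (dyadic_at n x) = measure \<nu> (dcell n \<lfloor>2 ^ n * x\<rfloor>)"
proof (rule measure_eq_AE)
  show "AE y in \<nu>. y \<in> dyadic_at n x \<longleftrightarrow> y \<in> dcell n \<lfloor>2 ^ n * x\<rfloor>"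
    using AE_mixture_unit
  proof eventually_elim
    case (elim y)
    show ?case
      using mem_dyadic_interval_iff[OF elim floor_dyadic_bounds(2)[OF assms, of n]] floor_dyadic_bounds(1)[OF assms, of n]
      by (simp add: dyadic_at_eq[OF assms] dcell_def)
  qed
  show "dyadic_at n x \<in> sets \<nu>" using dyadic_measurable[OF dyadic_at_mem(1)[OF assms]] by simp
qed simp

lemma measure_cell_bounds:
  fixes x :: real
  assumes "x \<in> {0..<1}"
  shows "measure \<nu> (dcell n \<lfloor>2 ^ n * x\<rfloor>) \<le> (1 - p_minus) ^ n" "p_minus ^ n \<le> measure \<nu> (dcell n \<lfloor>2 ^ n * x\<rfloor>)"
proof -
  let ?w = "\<lambda>p :: real. p ^ ones n x * (1 - p) ^ (n - ones n x)"
  have "AE p in \<rho>. ?w p \<le> (1 - p_minus) ^ n" "AE p in \<rho>. p_minus ^ n \<le> ?w p"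
    subgoal using AE_range by eventually_elim (erule weight_bounds[OF _ ones_le])
    subgoal using AE_range by eventually_elim (erule weight_bounds[OF _ ones_le])
    done
  then have "(\<integral>p. ?w p \<partial>\<rho>) \<le> (\<integral>p. (1 - p_minus) ^ n \<partial>\<rho>)"
    "(\<integral>p. p_minus ^ n \<partial>\<rho>) \<le> (\<integral>p. ?w p \<partial>\<rho>)"
    by (simp_all only: integral_mono_AE integrable_weight ones_le \<rho>.integrable_const)
  then show "measure \<nu> (dcell n \<lfloor>2 ^ n * x\<rfloor>) \<le> (1 - p_minus) ^ n"
    "p_minus ^ n \<le> measure \<nu> (dcell n \<lfloor>2 ^ n * x\<rfloor>)"
    using \<rho>.prob_space by (simp_all add: measure_mixture_dcell[OF assms])
qed

lemma measure_dyadic_le: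
  assumes "Q \<in> dyadic n"
  shows "measure \<nu> Q \<le> (1 - p_minus) ^ n"
  using dyadic_eq_dyadic_at[OF assms] measure_dyadic_at measure_cell_bounds(1) by metis

text \<open>A cell that meets \<open>{0..<1}\<close> is the cell of one of its points; every other
  cell is null.\<close>

lemma measure_dcell_le: "measure \<nu> (dcell n k) \<le> (1 - p_minus) ^ n"
proof (cases "\<exists>x\<in>{0..<1::real}. \<lfloor>2 ^ n * x\<rfloor> = k")
  case True
  then show ?thesis using measure_cell_bounds(1) by blast
next
  case False
  have "AE x in \<nu>. x \<notin> dcell n k"
    using AE_mixture_unit by eventually_elim (use False in \<open>auto simp: dcell_def\<close>)
  then have "measure \<nu> (dcell n k) = measure \<nu> {}"
    by (intro measure_eq_AE) auto
  then show ?thesis using p_bounds by simp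
qed

section \<open>Local dimension\<close>

lemma local_dim_at_level_eq:
  assumes "x \<in> {0..<1}"
  shows "local_dim_at_level \<nu> n x = - log 2 (measure \<nu> (dcell n \<lfloor>2 ^ n * x\<rfloor>)) / real n"
  by (simp add: local_dim_at_level_def measure_dyadic_at[OF assms])

lemma local_dim_at_level_measurable [measurable]: "local_dim_at_level \<nu> n \<in> borel_measurable borel"
proof -
  have "(\<lambda>k. measure \<nu> (dcell n k)) \<in> measurable (count_space UNIV) borel" by simp
  then have [measurable]: "(\<lambda>x :: real. measure \<nu> (dcell n \<lfloor>2 ^ n * x\<rfloor>)) \<in> borel_measurable borel" by measurable
  \<comment> \<open>This eliminates the definite description in \<open>dyadic_at\<close>: the floor
    formula holds on \<open>{0..<1}\<close>, the value is constant off the unit interval, and the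
    single point \<open>1\<close> remains.\<close>
  have "local_dim_at_level \<nu> n = (\<lambda>x. if x \<in> {0..<1} then - log 2 (measure \<nu> (dcell n \<lfloor>2 ^ n * x\<rfloor>)) / real n
      else if x = 1 then local_dim_at_level \<nu> n 1 else local_dim_at_level \<nu> n 2)"
  proof (rule ext)
    fix x :: real
    show "local_dim_at_level \<nu> n x = (if x \<in> {0..<1} then - log 2 (measure \<nu> (dcell n \<lfloor>2 ^ n * x\<rfloor>)) / real n
      else if x = 1 then local_dim_at_level \<nu> n 1 else local_dim_at_level \<nu> n 2)"
    proof (cases "x \<in> {0..1}")
      case True
      then show ?thesis by (cases "x = 1") (simp_all add: local_dim_at_level_eq)
    next
      case False
      then show ?thesis unfolding local_dim_at_level_def by (subst dyadic_at_outside[OF False]) auto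
    qed
  qed
  also have "\<dots> \<in> borel_measurable borel" by measurable
  finally show ?thesis .
qed

lemma local_dim_measurable [measurable]: "local_dim \<nu> \<in> borel_measurable borel"
  unfolding local_dim_def[abs_def] by measurable

lemma digit_freq_measurable [measurable]: "digit_freq \<in> borel_measurable borel"
  unfolding digit_freq_def[abs_def] by measurable

text \<open>The parameters with a null neighbourhood are covered by the null sets of a countable
  base, hence form a null set.\<close>

lemma AE_rho_support: "AE p in \<rho>. \<forall>U. open U \<longrightarrow> p \<in> U \<longrightarrow> 0 < measure \<rho> U"
proof -
  obtain B :: "real set set" where B: "countable B" "topological_basis B"
    using ex_countable_basis by blast
  have "AE p in \<rho>. \<forall>b\<in>B. p \<in> b \<longrightarrow> 0 < measure \<rho> b"
  proof (subst AE_ball_countable[OF B(1)], intro ballI)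
    fix b assume "b \<in> B"
    then have b: "b \<in> sets \<rho>" using topological_basis_open[OF B(2)] by simp
    show "AE p in \<rho>. p \<in> b \<longrightarrow> 0 < measure \<rho> b"
    proof (cases "measure \<rho> b = 0")
      case True
      then have "AE p in \<rho>. p \<notin> b"
        using b by (intro AE_not_in null_setsI) (simp_all add: \<rho>.emeasure_eq_measure)
      then show ?thesis by eventually_elim simp
    qed (simp add: zero_less_measure_iff)
  qed
  then show ?thesis
  proof eventually_elim
    case (elim p)
    show ?case
    proof (intro allI impI)
      fix U :: "real set" assume U: "open U" "p \<in> U"
      obtain b where b: "b \<in> B" "p \<in> b" "b \<subseteq> U" using topological_basisE[OF B(2) U] .
      have "0 < measure \<rho> b" using elim b by blast
      also have "\<dots> \<le> measure \<rho> U" using U b by (intro \<rho>.finite_measure_mono) auto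
      finally show "0 < measure \<rho> U" .
    qed
  qed
qed

text \<open>A Laplace-type estimate: in the average of
  \<open>2 powr (- n * cross_entropy t q)\<close> over \<open>q\<close>, with \<open>t\<close> the
  empirical frequency, the smallest exponent dominates, and in the limit it is attained at the
  support point \<open>q = p\<close>.\<close>

lemma local_dim_at_level_tendsto:
  assumes p: "p \<in> {p_minus..p_plus}" and supp: "\<And>U. open U \<Longrightarrow> p \<in> U \<Longrightarrow> 0 < measure \<rho> U"
    and x: "x \<in> {0..<1}" and freq: "(\<lambda>n. digit_average n x) \<longlonglongrightarrow> p"
  shows "(\<lambda>n. local_dim_at_level \<nu> n x) \<longlonglongrightarrow> h2 p"
proof -
  let ?t = "\<lambda>n. digit_average n x"
  let ?m = "\<lambda>n. measure \<nu> (dcell n \<lfloor>2 ^ n * x\<rfloor>)"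
  let ?w = "\<lambda>n (q :: real). q ^ ones n x * (1 - q) ^ (n - ones n x)"
  have p01: "0 < p" "p < 1" using range_unit[OF p] by auto
  have mpos: "0 < ?m n" for n
    by (rule less_le_trans[OF _ measure_cell_bounds(2)[OF x]]) (use p_bounds in simp)
  have weight: "?w n q = 2 powr (- real n * cross_entropy (?t n) q)" if "0 < q" "q < 1" "0 < n" for n q
    unfolding digit_average_eq by (rule bernoulli_weight_eq_powr[OF that(1,2) ones_le that(3)])
  have t01: "\<forall>\<^sub>F n in sequentially. 0 < ?t n \<and> ?t n < 1 \<and> 0 < n"
    using order_tendstoD(1)[OF freq p01(1)] order_tendstoD(2)[OF freq p01(2)] eventually_gt_at_top[of 0]
    by eventually_elim simp
  have lower: "\<forall>\<^sub>F n in sequentially. h2 (?t n) \<le> local_dim_at_level \<nu> n x"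
    using t01
  proof eventually_elim
    case (elim n)
    have "?m n \<le> (\<integral>q. 2 powr (- real n * h2 (?t n)) \<partial>\<rho>)"
      unfolding measure_mixture_dcell[OF x]
    proof (rule integral_mono_AE[OF integrable_weight[OF ones_le]])
      show "AE q in \<rho>. ?w n q \<le> 2 powr (- real n * h2 (?t n))"
        using AE_range
      proof eventually_elim
        case q: (elim q)
        then have "h2 (?t n) \<le> cross_entropy (?t n) q"
          using elim range_unit[OF q] by (intro h2_le_cross_entropy) auto
        then show ?case
          using elim range_unit[OF q] by (simp add: weight)
      qed
    qed simp
    then have "?m n \<le> 2 powr (- real n * h2 (?t n))" using \<rho>.prob_space by simp
    then have "log 2 (?m n) \<le> - real n * h2 (?t n)" using mpos by (subst log_le_iff) auto
    then show ?case unfolding local_dim_at_level_eq[OF x] using elim by (simp add: field_simps)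
  qed
  have "(\<lambda>n. h2 (?t n)) \<longlonglongrightarrow> h2 p"
    unfolding h2_def using p01 freq by (intro tendsto_intros) auto
  have upper: "\<forall>\<^sub>F n in sequentially. local_dim_at_level \<nu> n x < h2 p + e" if "0 < e" for e
  proof -
    \<comment> \<open>On this neighbourhood of \<open>p\<close>, \<open>log 2 q\<close> and
      \<open>log 2 (1 - q)\<close> fall short of their values at \<open>p\<close> by less than
      \<open>e / 2\<close>. As \<open>t\<close> and \<open>1 - t\<close> sum to \<open>1\<close>,
      the cross entropy rises by at most \<open>e / 2\<close>, uniformly in
      \<open>t\<close>.\<close>
    define U where "U = {q. 0 < q \<and> q < 1 \<and> p * 2 powr (- e / 2) < q \<and> (1 - p) * 2 powr (- e / 2) < 1 - q}"
    have c1: "2 powr (- e / 2) < 1" using that by (simp add: powr_less_one)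
    have "open U" unfolding U_def by (intro open_Collect_conj open_Collect_less continuous_intros)
    moreover have "p \<in> U" unfolding U_def using p01 c1 by simp
    ultimately have Upos: "0 < measure \<rho> U" by (rule supp)
    have ce: "cross_entropy t q \<le> cross_entropy t p + e / 2" if q: "q \<in> U" and t: "0 < t" "t < 1" for t q
    proof -
      have "log 2 (p * 2 powr (- e / 2)) \<le> log 2 q" "log 2 ((1 - p) * 2 powr (- e / 2)) \<le> log 2 (1 - q)"
        using q p01 by (auto simp: U_def)
      then have "log 2 p - e / 2 \<le> log 2 q" "log 2 (1 - p) - e / 2 \<le> log 2 (1 - q)"
        using p01 by (simp_all add: log_mult)
      then have "t * (log 2 p - e / 2) \<le> t * log 2 q" "(1 - t) * (log 2 (1 - p) - e / 2) \<le> (1 - t) * log 2 (1 - q)"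
        using t by (auto intro!: mult_left_mono)
      then show ?thesis by (simp add: cross_entropy_def algebra_simps diff_divide_distrib)
    qed
    have le: "\<forall>\<^sub>F n in sequentially. local_dim_at_level \<nu> n x \<le> - log 2 (measure \<rho> U) / real n + cross_entropy (?t n) p + e / 2"
      using t01
    proof eventually_elim
      case (elim n)
      let ?c = "2 powr (- real n * (cross_entropy (?t n) p + e / 2))"
      \<comment> \<open>Restricting the average to \<open>U\<close> costs the factor
        \<open>measure \<rho> U\<close>, whose logarithm vanishes after division by
        \<open>n\<close>.\<close>
      have "?c * measure \<rho> U = (\<integral>q. ?c * indicator U q \<partial>\<rho>)"
        using \<open>open U\<close> by simp
      also have "\<dots> \<le> ?m n"
        unfolding measure_mixture_dcell[OF x]
      proof (rule integral_mono_AE[OF _ integrable_weight[OF ones_le]])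
        show "integrable \<rho> (\<lambda>q. ?c * indicator U q)"
          using \<open>open U\<close> by (intro integrable_mult_right integrable_real_indicator) (auto simp: \<rho>.emeasure_eq_measure)
        show "AE q in \<rho>. ?c * indicator U q \<le> ?w n q"
          using AE_range
        proof eventually_elim
          case q: (elim q)
          show ?case
          proof (cases "q \<in> U")
            case True
            have "real n * cross_entropy (?t n) q \<le> real n * (cross_entropy (?t n) p + e / 2)"
              using ce[OF True, of "?t n"] elim by (intro mult_left_mono) auto
            then show ?thesis using True elim range_unit[OF q] by (simp add: weight)
          next
            case False
            then show ?thesis using range_unit[OF q] by simp
          qed
        qed
      qed
      finally have "log 2 (?c * measure \<rho> U) \<le> log 2 (?m n)"
        using Upos mpos by (subst log_le_cancel_iff) auto
      then have "- real n * (cross_entropy (?t n) p + e / 2) + log 2 (measure \<rho> U) \<le> log 2 (?m n)"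
        using Upos by (simp add: log_mult)
      then have "- log 2 (?m n) / real n \<le> (- log 2 (measure \<rho> U) + real n * (cross_entropy (?t n) p + e / 2)) / real n"
        by (intro divide_right_mono) auto
      then show ?case unfolding local_dim_at_level_eq[OF x] using elim
        by (simp add: add_divide_distrib diff_divide_distrib)
    qed
    have "(\<lambda>n. - log 2 (measure \<rho> U) / real n + cross_entropy (?t n) p + e / 2) \<longlonglongrightarrow> 0 + cross_entropy p p + e / 2"
      unfolding cross_entropy_def using p01 freq by (intro tendsto_intros lim_const_over_n) auto
    then have "\<forall>\<^sub>F n in sequentially. - log 2 (measure \<rho> U) / real n + cross_entropy (?t n) p + e / 2 < h2 p + e"
      using that by (intro order_tendstoD) (auto simp: cross_entropy_self)
    with le show ?thesis by eventually_elim simp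
  qed
  show ?thesis
  proof (rule order_tendstoI)
    fix y assume "y < h2 p"
    then have "\<forall>\<^sub>F n in sequentially. y < h2 (?t n)"
      using \<open>(\<lambda>n. h2 (?t n)) \<longlonglongrightarrow> h2 p\<close> by (rule order_tendstoD(1)[rotated])
    with lower show "\<forall>\<^sub>F n in sequentially. y < local_dim_at_level \<nu> n x" by eventually_elim simp
  next
    fix y assume "h2 p < y"
    then show "\<forall>\<^sub>F n in sequentially. local_dim_at_level \<nu> n x < y" using upper[of "y - h2 p"] by simp
  qed
qed

text \<open>Under \<open>bernoulli_measure p\<close> the digit frequency is almost surely
  \<open>p\<close>, so the claim reduces to one about the parameter, which may be taken in the
  support of \<open>\<rho>\<close>.\<close>

lemma AE_mixture_local_dim:
  "AE x in \<nu>. (\<lambda>n. digit_average n x) \<longlonglongrightarrow> digit_freq x \<and>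
     (\<lambda>n. local_dim_at_level \<nu> n x) \<longlonglongrightarrow> h2 (digit_freq x) \<and> digit_freq x \<in> {p_minus..p_plus}"
proof (subst AE_mixture_iff)
  show "AE p in \<rho>. AE x in bernoulli_measure p. (\<lambda>n. digit_average n x) \<longlonglongrightarrow> digit_freq x \<and>
     (\<lambda>n. local_dim_at_level \<nu> n x) \<longlonglongrightarrow> h2 (digit_freq x) \<and> digit_freq x \<in> {p_minus..p_plus}"
    using AE_range AE_rho_support
  proof eventually_elim
    case p: (elim p)
    have "0 \<le> p" "p < 1" using range_unit[OF p(1)] by auto
    from AE_bernoulli_measure_unit[OF this] AE_bernoulli_measure_digit_average[OF this]
    show ?case
    proof eventually_elim
      case (elim x)
      then have "digit_freq x = p" unfolding digit_freq_def by (intro limI)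
      then show ?case using elim p local_dim_at_level_tendsto[OF p(1) _ elim] by simp
    qed
  qed
qed measurable

text \<open>Under \<open>bernoulli_measure p\<close> the preimage of \<open>A\<close> has mass
  \<open>1\<close> or \<open>0\<close> according to whether \<open>p \<in> A\<close>, so the mixture
  integrates the indicator of \<open>A\<close>.\<close>

lemma distr_digit_freq: "distr \<nu> borel digit_freq = \<rho>"
proof (rule measure_eqI)
  fix A assume "A \<in> sets (distr \<nu> borel digit_freq)"
  then have A [measurable]: "A \<in> sets borel" by simp
  have V: "digit_freq -` A \<in> sets borel" using measurable_sets[OF digit_freq_measurable A] by simp
  have "emeasure (distr \<nu> borel digit_freq) A = emeasure \<nu> (digit_freq -` A)"
    by (subst emeasure_distr) auto
  also have "\<dots> = (\<integral>\<^sup>+p. emeasure (bernoulli_measure p) (digit_freq -` A) \<partial>\<rho>)"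
    using V by (intro emeasure_bernoulli_mixture) (auto intro: \<rho>.prob_space_axioms)
  also have "\<dots> = (\<integral>\<^sup>+p. indicator A p \<partial>\<rho>)"
  proof (rule nn_integral_cong_AE)
    show "AE p in \<rho>. emeasure (bernoulli_measure p) (digit_freq -` A) = indicator A p"
      using AE_range
    proof eventually_elim
      case (elim p)
      interpret B: prob_space "bernoulli_measure p" by (rule prob_space_bernoulli)
      have sp: "space (bernoulli_measure p) = UNIV"
        using sets_eq_imp_space_eq[OF sets_bernoulli_measure[of p]] by simp
      have "0 \<le> p" "p < 1" using range_unit[OF elim] by auto
      from AE_bernoulli_measure_digit_average[OF this]
      have "AE x in bernoulli_measure p. x \<in> digit_freq -` A \<longleftrightarrow> x \<in> (if p \<in> A then UNIV else {})"
      proof eventually_elim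
        case (elim x)
        then have "digit_freq x = p" unfolding digit_freq_def by (intro limI)
        then show ?case by simp
      qed
      then have "emeasure (bernoulli_measure p) (digit_freq -` A) =
          emeasure (bernoulli_measure p) (if p \<in> A then UNIV else {})"
        by (rule emeasure_eq_AE) (use V in auto)
      then show ?case using B.emeasure_space_1 by (simp add: sp)
    qed
  qed
  finally show "emeasure (distr \<nu> borel digit_freq) A = emeasure \<rho> A" by simp
qed simp

lemma AE_local_dim_eq: "AE x in \<nu>. local_dim \<nu> x = h2 (digit_freq x)"
  using AE_mixture_local_dim by eventually_elim (auto simp: local_dim_def intro: limI)

lemma distr_local_dim: "distr \<nu> borel (local_dim \<nu>) = distr \<rho> borel h2"
proof -
  have "distr \<nu> borel (local_dim \<nu>) = distr \<nu> borel (h2 \<circ> digit_freq)"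
    using AE_local_dim_eq by (intro distr_cong_AE) auto
  also have "\<dots> = distr (distr \<nu> borel digit_freq) borel h2"
    by (subst distr_distr) auto
  finally show ?thesis by (simp add: distr_digit_freq)
qed

section \<open>Integrals over the parameter and entropy\<close>

lemma integral_digit_freq:
  fixes f :: "real \<Rightarrow> real"
  assumes [measurable]: "f \<in> borel_measurable borel"
  shows "(\<integral>x. f (digit_freq x) \<partial>\<nu>) = (LINT p:{p_minus..p_plus}|\<rho>. f p)"
proof -
  have "(\<integral>x. f (digit_freq x) \<partial>\<nu>) = (\<integral>p. f p \<partial>distr \<nu> borel digit_freq)"
    by (subst integral_distr) auto
  also have "\<dots> = (LINT p:{p_minus..p_plus}|\<rho>. f p)"
    unfolding distr_digit_freq set_lebesgue_integral_def
  proof (rule integral_cong_AE)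
    show "AE p in \<rho>. f p = indicator {p_minus..p_plus} p *\<^sub>R f p"
      using AE_range by eventually_elim simp
  qed measurable
  finally show ?thesis .
qed

text \<open>Entropy is mean information: up to a null set \<open>local_dim_at_level\<close> is
  constant on each dyadic interval, with value \<open>- log 2 (measure \<nu> Q) / k\<close>.\<close>

lemma entropy_at_level_eq: "entropy_at_level \<nu> k = (\<integral>x. local_dim_at_level \<nu> k x \<partial>\<nu>)"
proof -
  have "(\<integral>x. local_dim_at_level \<nu> k x \<partial>\<nu>) =
     (\<integral>x. (\<Sum>Q\<in>dyadic k. (- 1 / real k * log 2 (measure \<nu> Q)) * indicator Q x) \<partial>\<nu>)"
  proof (rule integral_cong_AE)
    show "AE x in \<nu>. local_dim_at_level \<nu> k x = (\<Sum>Q\<in>dyadic k. (- 1 / real k * log 2 (measure \<nu> Q)) * indicator Q x)"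
      using AE_mixture_unit
    proof eventually_elim
      case (elim x)
      have "(\<Sum>Q\<in>dyadic k. (- 1 / real k * log 2 (measure \<nu> Q)) * indicator Q x) =
          (\<Sum>Q\<in>dyadic k. if Q = dyadic_at k x then - 1 / real k * log 2 (measure \<nu> Q) else 0)"
        by (intro sum.cong refl) (simp add: indicator_def mem_dyadic_iff[OF elim])
      then show ?case
        using dyadic_at_mem(1)[OF elim, of k] by (simp add: finite_dyadic local_dim_at_level_def)
    qed
  qed (use dyadic_measurable in \<open>auto intro!: borel_measurable_sum borel_measurable_times\<close>)
  also have "\<dots> = (\<Sum>Q\<in>dyadic k. (- 1 / real k * log 2 (measure \<nu> Q)) * measure \<nu> Q)"
    using dyadic_measurable[of _ k]
    by (subst Bochner_Integration.integral_sum)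
       (auto intro!: integrable_mult_right integrable_real_indicator simp: N.emeasure_eq_measure)
  also have "\<dots> = entropy_at_level \<nu> k"
    unfolding entropy_at_level_def sum_distrib_left by (intro sum.cong refl) simp
  finally show ?thesis ..
qed

lemma entropy_tendsto: "entropy_at_level \<nu> \<longlonglongrightarrow> (LINT p:{p_minus..p_plus}|\<rho>. h2 p)"
proof -
  have "(\<lambda>k. \<integral>x. local_dim_at_level \<nu> k x \<partial>\<nu>) \<longlonglongrightarrow> (\<integral>x. h2 (digit_freq x) \<partial>\<nu>)"
  proof (rule integral_dominated_convergence[where w = "\<lambda>_. - log 2 p_minus"])
    show "AE x in \<nu>. (\<lambda>k. local_dim_at_level \<nu> k x) \<longlonglongrightarrow> h2 (digit_freq x)"
      using AE_mixture_local_dim by eventually_elim simp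
    show "AE x in \<nu>. norm (local_dim_at_level \<nu> k x) \<le> - log 2 p_minus" for k
      using AE_mixture_unit
    proof eventually_elim
      case (elim x)
      let ?m = "measure \<nu> (dcell k \<lfloor>2 ^ k * x\<rfloor>)"
      \<comment> \<open>The exponential lower bound for cell masses yields the constant majorant for
        dominated convergence.\<close>
      have m: "0 < p_minus ^ k" "p_minus ^ k \<le> ?m" "?m \<le> 1"
        using p_bounds measure_cell_bounds(2)[OF elim] by simp_all
      then have "log 2 (p_minus ^ k) \<le> log 2 ?m" "log 2 ?m \<le> 0" by simp_all
      then have "real k * log 2 p_minus \<le> log 2 ?m" using p_bounds by (simp add: log_nat_power)
      moreover have "log 2 p_minus \<le> 0" using p_bounds by simp
      \<comment> \<open>At \<open>k = 0\<close> the quotient is \<open>0\<close> by the convention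
        for division by zero.\<close>
      ultimately show ?case using \<open>log 2 ?m \<le> 0\<close>
        by (cases "k = 0") (simp_all add: local_dim_at_level_eq[OF elim] field_simps)
    qed
  qed simp_all
  then show ?thesis by (simp add: entropy_at_level_eq[abs_def] integral_digit_freq)
qed

section \<open>Atoms and support\<close>

text \<open>A point lies in one cell of every level, and the masses of these cells tend to
  \<open>0\<close>.\<close>

lemma mixture_atomless: "emeasure \<nu> {x} = 0"
proof -
  have "(\<lambda>n. (1 - p_minus) ^ n) \<longlonglongrightarrow> 0"
    using p_bounds by (intro LIMSEQ_realpow_zero) auto
  moreover have "measure \<nu> {x} \<le> (1 - p_minus) ^ n" for n
  proof -
    have "measure \<nu> {x} \<le> measure \<nu> (dcell n \<lfloor>2 ^ n * x\<rfloor>)"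
      by (intro N.finite_measure_mono) (auto simp: dcell_def)
    then show ?thesis using measure_dcell_le by (rule order.trans)
  qed
  ultimately have "measure \<nu> {x} \<le> 0"
    by (intro LIMSEQ_le_const[where X = "\<lambda>n. (1 - p_minus) ^ n"]) auto
  then have "measure \<nu> {x} = 0" by (rule antisym) simp
  then show ?thesis by (simp add: N.emeasure_eq_measure)
qed

text \<open>Every ball around a point of the unit interval contains a dyadic interval of some level
  \<open>n\<close>, whose mass is at least \<open>p_minus ^ n\<close>.\<close>

lemma mixture_support: "msupport \<nu> = {0..1}"
proof (intro equalityI subsetI)
  fix x assume x: "x \<in> msupport \<nu>"
  show "x \<in> {0..1}"
  proof (rule ccontr)
    assume nx: "x \<notin> {0..1}"
    have "open (- {0..1::real})" by (simp add: open_Compl)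
    then have pos: "0 < emeasure \<nu> (- {0..1})" using x nx by (auto simp: msupport_def)
    have "emeasure \<nu> (- {0..1}) = emeasure \<nu> {}"
      by (rule emeasure_eq_AE) (use AE_mixture_unit in \<open>auto elim: eventually_mono\<close>)
    then show False using pos by simp
  qed
next
  fix x :: real assume x: "x \<in> {0..1}"
  have "0 < emeasure \<nu> U" if U: "open U" "x \<in> U" for U
  proof -
    obtain e where e: "0 < e" "ball x e \<subseteq> U" using U by (meson open_contains_ball)
    \<comment> \<open>The point \<open>1\<close> is outside \<open>{0..<1}\<close>, so it is
      replaced by a point within \<open>e / 2\<close>; the maximum with \<open>0\<close> covers
      large \<open>e\<close>.\<close>
    define y where "y = (if x < 1 then x else max 0 (1 - e / 2))"
    have y: "y \<in> {0..<1}" "dist x y \<le> e / 2" using x e(1) by (auto simp: y_def dist_real_def max_def)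
    obtain n where n: "1 / 2 ^ n < e / 2"
      using real_arch_pow_inv[of "e / 2" "1 / 2"] e(1) by (auto simp: power_one_over)
    have "dyadic_at n y \<subseteq> ball y (e / 2)" by (rule dyadic_at_ball[OF y(1) n])
    also have "\<dots> \<subseteq> ball x e" proof
      fix z assume "z \<in> ball y (e / 2)"
      then show "z \<in> ball x e" using y(2) dist_triangle[of x z y] by simp
    qed
    finally have "measure \<nu> (dyadic_at n y) \<le> measure \<nu> U"
      using U(1) e(2) by (intro N.finite_measure_mono) auto
    moreover have "0 < p_minus ^ n" using p_bounds by simp
    ultimately have "0 < measure \<nu> U"
      using measure_cell_bounds(2)[OF y(1), of n] by (simp add: measure_dyadic_at[OF y(1)])
    then show ?thesis by (simp add: N.emeasure_eq_measure)
  qed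
  then show "x \<in> msupport \<nu>" by (simp add: msupport_def)
qed

definition exponent :: real where "exponent = - log 2 (1 - p_minus)"

lemma exponent_pos: "0 < exponent"
  unfolding exponent_def using p_bounds by simp

lemma powr_exponent: "2 powr (- exponent * real n) = (1 - p_minus) ^ n"
proof -
  have "2 powr (- exponent * real n) = (2 powr log 2 (1 - p_minus)) powr real n"
    by (simp add: exponent_def powr_powr)
  then show ?thesis using p_bounds by (simp add: powr_realpow)
qed

text \<open>The abstract limit applies with \<open>s\<close> the binary entropy of the digit
  frequency; pushing forward by the frequency turns the integral over \<open>x\<close> into one over
  \<open>p\<close>.\<close>

lemma quant_ratio0_mixture_tendsto:
  "quant_ratio0 \<nu> \<longlonglongrightarrow> inverse (LINT p:{p_minus..p_plus}|\<rho>. 1 / h2 p)"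
proof -
  interpret dyadic_local_dim \<nu> exponent "\<lambda>x. h2 (digit_freq x)"
  proof
    show "AE x in \<nu>. x \<in> {0..<1}" by (rule AE_mixture_unit)
    show "0 < exponent" by (rule exponent_pos)
    show "measure \<nu> (dcell n k) \<le> 2 powr (- exponent * real n)" for n k
      unfolding powr_exponent by (rule measure_dcell_le)
    show "AE x in \<nu>. 0 < h2 (digit_freq x)"
      using AE_mixture_local_dim by eventually_elim (use range_unit h2_pos in blast)
    show "AE x in \<nu>. (\<lambda>n. - log 2 (measure \<nu> (dcell n \<lfloor>2 ^ n * x\<rfloor>)) / real n) \<longlonglongrightarrow> h2 (digit_freq x)"
      using AE_mixture_local_dim AE_mixture_unit
      by eventually_elim (simp add: local_dim_at_level_eq)
  qed simp_all
  show ?thesis using quant_ratio0_tendsto by (simp add: integral_digit_freq[of "\<lambda>p. 1 / h2 p"])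
qed

end

theorem proposition6p1:
  fixes p_minus p_plus :: real and \<rho> :: "real measure"
  assumes "0 < p_minus" and "p_minus < p_plus" and "p_plus \<le> 1 / 2"
    and "prob_space \<rho>" and "sets \<rho> = sets borel"
    and "emeasure \<rho> {p_minus..p_plus} = 1"
  shows "let \<nu> = bernoulli_mixture \<rho>; a = - log 2 (1 - p_minus); C = 1 in
    (\<forall>x. emeasure \<nu> {x} = 0) \<and>
    msupport \<nu> = {0..1} \<and>
    (\<forall>n. \<forall>Q\<in>dyadic n. measure \<nu> Q \<le> (1 - p_minus) ^ n) \<and>
    a > 0 \<and>
    (\<forall>n. \<forall>Q\<in>dyadic n. measure \<nu> Q \<le> C * 2 powr (- a * real n)) \<and>
    (AE x in \<nu>. convergent (\<lambda>n. digit_average n x) \<and>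
                convergent (\<lambda>n. local_dim_at_level \<nu> n x) \<and>
                local_dim \<nu> x = h2 (digit_freq x)) \<and>
    distr \<nu> borel digit_freq = \<rho> \<and>
    distr \<nu> borel (local_dim \<nu>) = distr \<rho> borel h2 \<and>
    convergent (entropy_at_level \<nu>) \<and>
    convergent (quant_ratio0 \<nu>) \<and>
    entropy_dim \<nu> = (LINT p:{p_minus..p_plus}|\<rho>. h2 p) \<and>
    quant_dim0 \<nu> = inverse (LINT p:{p_minus..p_plus}|\<rho>. 1 / h2 p)"
proof -
  interpret \<rho>: prob_space \<rho> by fact
  interpret bernoulli_mix \<rho> p_minus p_plus by unfold_locales fact+
  have "AE x in bernoulli_mixture \<rho>. convergent (\<lambda>n. digit_average n x) \<and>
      convergent (\<lambda>n. local_dim_at_level (bernoulli_mixture \<rho>) n x) \<and>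
      local_dim (bernoulli_mixture \<rho>) x = h2 (digit_freq x)"
    using AE_mixture_local_dim AE_local_dim_eq by eventually_elim (auto intro: convergentI)
  then show ?thesis
    using mixture_atomless mixture_support measure_dyadic_le exponent_pos powr_exponent
      distr_digit_freq distr_local_dim entropy_tendsto quant_ratio0_mixture_tendsto
    unfolding Let_def entropy_dim_def quant_dim0_def exponent_def
    by (auto intro: convergentI limI)
qed

end
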